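(* Let $(X_t,Y_t)_{t\ge 0}$ be a continuous time hidden Markov model as described in the context, with signal state space $E$. Suppose that $E$ is compact and that the Markov process $(X_t,Y_t)_{t\ge0}$ is Feller. If the model is observable, that is, if for all $\mu,\nu\in P(E)$, $\mathbf{P}^\mu|_{\mathcal{F}^Y}=\mathbf{P}^\nu|_{\mathcal{F}^Y}$ implies $\mu=\nu$, then the model is uniformly observable, that is, for all sequences $\{\mu_n\},\{\nu_n\}\subset P(E)$, $$\|\mathbf{P}^{\mu_n}|_{\mathcal{F}^Y}-\mathbf{P}^{\nu_n}|_{\mathcal{F}^Y}\|_{\mathrm{TV}}\xrightarrow{n\to\infty}0\quad\text{implies}\quad\|\mu_n-\nu_n\|_{\mathrm{BL}}\xrightarrow{n\to\infty}0.$$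
   Context: Notation. For a Polish space $S$ with complete metric $d_S$, $B(S)$ and $C_b(S)$ are the spaces of bounded measurable and bounded continuous real functions, and $P(S)$ is the space of Borel probability measures with the topology of weak convergence. $\mathrm{Lip}(S)=\{f\in C_b(S):\|f\|_\infty\le1,\ \|f\|_L\le1\}$ with $\|f\|_L=\sup_{x\ne y}|f(x)-f(y)|/d_S(x,y)$, and $\|\mu-\nu\|_{\mathrm{BL}}=\sup_{f\in\mathrm{Lip}(S)}|\int f\,d\mu-\int f\,d\nu|$. $\|\cdot\|_{\mathrm{TV}}$ is total variation distance, normalized as the supremum of differences of integrals of measurable functions with absolute value at most $1$. Hidden Markov model. $E$ is a Polish space with a fixed complete metric and $q\in\mathbb{N}$. $\Omega=D([0,\infty[;E)\times D([0,\infty[;\mathbb{R}^q)$ (càdlàg paths, Skorokhod topologies) with its Borel $\sigma$-field $\tilde{\mathcal F}$; $X_t(x,y)=x(t)$ and $Y_t(x,y)=y(t)$ are the coordinate projections. $\tilde{\mathcal F}_t^X=\sigma\{X_s:s\le t\}$, $\tilde{\mathcal F}_t^Y=\sigma\{Y_s:s\le t\}$, $\tilde{\mathcal F}_t=\tilde{\mathcal F}_t^X\vee\tilde{\mathcal F}_t^Y$, $\tilde{\mathcal F}^Y=\bigvee_{t\ge0}\tilde{\mathcal F}_t^Y$. A family $\{\mathbf{P}^\mu:\mu\in P(E)\}\subset P(\Omega)$ and a Markov semigroup $T_t:B(E\times\mathbb{R}^q)\to B(E\times\mathbb{R}^q)$ are given. $\mathcal F^Y$ denotes the completion of $\tilde{\mathcal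 F}^Y$, and $\mathcal F_t$ the usual augmentation of $\tilde{\mathcal F}_t$, with respect to the family $\{\mathbf{P}^\mu:\mu\in P(E)\}$. It is assumed that for every $\mu\in P(E)$, $f\in B(E\times\mathbb{R}^q)$ and $t\ge s\ge0$, $$\mathbf{E}^\mu(f(X_t,Y_t)|\mathcal F_s)=(T_{t-s}f)(X_s,Y_s),\qquad \mathbf{E}^\mu(f(X_t,Y_t))=\int (T_tf)(x,0)\,\mu(dx),$$ so $(X_t,Y_t)$ is Markov with initial law $\mu\otimes\delta_{\{0\}}$ under $\mathbf{P}^\mu$. It is also assumed that the model is Markov additive: for any $f\in B(E\times\mathbb{R}^q)$ and $t\ge0$, $(T_tS_yf)(x,y)$ does not depend on $y$, where $(S_yf)(x,z)=f(x,z-y)$. "Feller" has the standard meaning for the semigroup $T_t$ on the locally compact space $E\times\mathbb{R}^q$ (a strongly continuous semigroup on the space of continuous functions vanishing at infinity). *)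

theory Defs
  imports "HOL-Probability.Probability"
begin

text \<open>Paths on the half-line are functions on \<^typ>\<open>real\<close> that are fixed to \<^const>\<open>undefined\<close> at
  negative times, so that equality in the type is equality on the half-line.\<close>

definition is_cadlag :: "(real \<Rightarrow> 'a::topological_space) \<Rightarrow> bool" where
  "is_cadlag x \<longleftrightarrow>
     (\<forall>t\<ge>0. (x \<longlongrightarrow> x t) (at_right t)) \<and> (\<forall>t>0. \<exists>l. (x \<longlongrightarrow> l) (at_left t))"

lemma is_cadlag_const_on_nonneg:
  "is_cadlag (\<lambda>t. if 0 \<le> t then c else undefined)"
  unfolding is_cadlag_def
proof (intro conjI allI impI)
  fix t :: real assume t: "0 \<le> t"
  have "\<forall>\<^sub>F s in at_right t. (if 0 \<le> s then c else undefined) = c"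
    using t by (intro eventually_at_rightI[of t "t + 1"]) auto
  then show "((\<lambda>s. if 0 \<le> s then c else undefined) \<longlongrightarrow> (if 0 \<le> t then c else undefined)) (at_right t)"
    using t by (simp add: tendsto_eventually)
next
  fix t :: real assume t: "0 < t"
  have "\<forall>\<^sub>F s in at_left t. (if 0 \<le> s then c else undefined) = c"
    using t by (intro eventually_at_leftI[of 0 t]) auto
  then show "\<exists>l. ((\<lambda>s. if 0 \<le> s then c else undefined) \<longlongrightarrow> l) (at_left t)"
    by (blast intro: tendsto_eventually)
qed

typedef (overloaded) ('a::topological_space) cadlag =
  "{x :: real \<Rightarrow> 'a. x \<in> extensional {0..} \<and> is_cadlag x}"
  morphisms path_at Abs_cadlag
proof
  show "(\<lambda>t. if 0 \<le> t then c else undefined) \<in> {x. x \<in> extensional {0..} \<and> is_cadlag x}" for c :: 'a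
    by (simp add: is_cadlag_const_on_nonneg extensional_def)
qed

definition time_changes :: "(real \<Rightarrow> real) set" where
  "time_changes =
     {l. strict_mono_on {0..} l \<and> continuous_on {0..} l \<and> bij_betw l {0..} {0..}}"

definition skorokhod_tendsto :: "(nat \<Rightarrow> 'a::metric_space cadlag) \<Rightarrow> 'a cadlag \<Rightarrow> bool" where
  "skorokhod_tendsto xs x \<longleftrightarrow>
     (\<exists>l. (\<forall>n. l n \<in> time_changes) \<and>
          uniform_limit {0..} l (\<lambda>t. t) sequentially \<and>
          (\<forall>N::nat. uniform_limit {0..real N} (\<lambda>n t. path_at (xs n) (l n t)) (path_at x) sequentially))"

text \<open>The Skorokhod (J1) topology is the metrizable topology whose convergent sequences are the
  ones above.  As metrizable topologies are sequential, its open sets are exactly the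
  sequentially open ones, and this serves as the definition.\<close>

instantiation cadlag :: (metric_space) topological_space
begin

definition open_cadlag :: "'a cadlag set \<Rightarrow> bool" where
  "open_cadlag S \<longleftrightarrow>
     (\<forall>x\<in>S. \<forall>xs. skorokhod_tendsto xs x \<longrightarrow> (\<forall>\<^sub>F n in sequentially. xs n \<in> S))"

instance
proof
  show "open (UNIV :: 'a cadlag set)"
    by (simp add: open_cadlag_def)
  show "open (S \<inter> S')" if "open S" "open S'" for S S' :: "'a cadlag set"
    using that by (auto simp: open_cadlag_def intro: eventually_conj)
  show "open (\<Union>K)" if "\<forall>S\<in>K. open S" for K :: "'a cadlag set set"
    unfolding open_cadlag_def
  proof (intro ballI allI impI)
    fix x :: "'a cadlag" and xs
    assume "x \<in> \<Union>K" and conv: "skorokhod_tendsto xs x"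
    then obtain S where S: "S \<in> K" "x \<in> S" by blast
    with that conv have "\<forall>\<^sub>F n in sequentially. xs n \<in> S"
      unfolding open_cadlag_def by blast
    then show "\<forall>\<^sub>F n in sequentially. xs n \<in> \<Union>K"
      by (rule eventually_mono) (use S in blast)
  qed
qed

end

abbreviation borel_probs :: "'a::topological_space measure set" where
  "borel_probs \<equiv> space (prob_algebra borel)"

definition bounded_measurable :: "('a::topological_space \<Rightarrow> real) set" where
  "bounded_measurable = {f. f \<in> borel_measurable borel \<and> (\<exists>C. \<forall>z. \<bar>f z\<bar> \<le> C)}"

definition vanishing_at_infinity :: "('a::topological_space \<Rightarrow> real) set" where
  "vanishing_at_infinity = {f. continuous_on UNIV f \<and> (\<forall>\<epsilon>>0. compact {z. \<epsilon> \<le> \<bar>f z\<bar>})}"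

definition bl_dist :: "'a::metric_space measure \<Rightarrow> 'a measure \<Rightarrow> real" where
  "bl_dist \<mu> \<nu> =
     (SUP f \<in> {f. (\<forall>x. \<bar>f x\<bar> \<le> 1) \<and> 1-lipschitz_on UNIV f}. \<bar>(\<integral>x. f x \<partial>\<mu>) - (\<integral>x. f x \<partial>\<nu>)\<bar>)"

text \<open>Only meaningful for two finite measures on the same space and sigma-algebra.\<close>

definition tv_dist :: "'a measure \<Rightarrow> 'a measure \<Rightarrow> real" where
  "tv_dist M N =
     (SUP f \<in> {f. f \<in> borel_measurable M \<and> (\<forall>x\<in>space M. \<bar>f x\<bar> \<le> 1)}.
        \<bar>(\<integral>x. f x \<partial>M) - (\<integral>x. f x \<partial>N)\<bar>)"

type_synonym ('e, 'q) path_space = "'e cadlag \<times> (real ^ 'q) cadlag"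

definition signal_at :: "real \<Rightarrow> ('e::polish_space, 'q::finite) path_space \<Rightarrow> 'e" where
  "signal_at t \<omega> = path_at (fst \<omega>) t"

definition obs_at :: "real \<Rightarrow> ('e::polish_space, 'q::finite) path_space \<Rightarrow> real ^ 'q" where
  "obs_at t \<omega> = path_at (snd \<omega>) t"

text \<open>Sigma-fields on path space are represented by measures of which only the sigma-algebra matters.\<close>

definition raw_signal_filtration ::
    "real \<Rightarrow> ('e::polish_space, 'q::finite) path_space measure" where
  "raw_signal_filtration t =
     sigma UNIV {signal_at s -` A | s A. 0 \<le> s \<and> s \<le> t \<and> A \<in> sets borel}"

definition raw_obs_filtration ::
    "real \<Rightarrow> ('e::polish_space, 'q::finite) path_space measure" where
  "raw_obs_filtration t =
     sigma UNIV {obs_at s -` A | s A. 0 \<le> s \<and> s \<le> t \<and> A \<in> sets borel}"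

definition raw_filtration :: "real \<Rightarrow> ('e::polish_space, 'q::finite) path_space measure" where
  "raw_filtration t = sigma UNIV (sets (raw_signal_filtration t) \<union> sets (raw_obs_filtration t))"

definition raw_obs_field :: "('e::polish_space, 'q::finite) path_space measure" where
  "raw_obs_field = sigma UNIV (\<Union>t\<in>{0..}. sets (raw_obs_filtration t))"

text \<open>Completion with respect to a family of measures is the intersection of the completions with
  respect to its members.  The intersections below are already sigma-algebras; \<^const>\<open>sigma\<close> only
  packages them.\<close>

definition obs_field ::
    "('e::polish_space measure \<Rightarrow> ('e, 'q::finite) path_space measure)
       \<Rightarrow> ('e, 'q) path_space measure" where
  "obs_field P =
     sigma UNIV (\<Inter>\<mu>\<in>borel_probs. sets (completion (restr_to_subalg (P \<mu>) raw_obs_field)))"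

text \<open>The usual augmentation: right-continuous, and containing the null sets of the completed
  full path space, separately for each member of the family.\<close>

definition augmented_filtration ::
    "('e::polish_space measure \<Rightarrow> ('e, 'q::finite) path_space measure)
       \<Rightarrow> real \<Rightarrow> ('e, 'q) path_space measure" where
  "augmented_filtration P t =
     sigma UNIV (\<Inter>\<mu>\<in>borel_probs. \<Inter>u\<in>{t<..}.
       sigma_sets UNIV (sets (raw_filtration u) \<union> null_sets (completion (P \<mu>))))"

text \<open>The sigma-field \<^const>\<open>obs_field\<close> contains sets that need not be Borel, so the law is first
  extended to its completion.\<close>

definition obs_law ::
    "('e::polish_space measure \<Rightarrow> ('e, 'q::finite) path_space measure)
       \<Rightarrow> 'e measure \<Rightarrow> ('e, 'q) path_space measure" where
  "obs_law P \<mu> = restr_to_subalg (completion (P \<mu>)) (obs_field P)"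

definition obs_shift :: "'y::minus \<Rightarrow> ('e \<times> 'y \<Rightarrow> real) \<Rightarrow> 'e \<times> 'y \<Rightarrow> real" where
  "obs_shift y f = (\<lambda>(x, z). f (x, z - y))"

text \<open>Operators are total on functions; only their action on bounded measurable functions matters.
  Countable additivity of the kernels is not demanded here: in \<open>hidden_markov_model\<close> it follows from
  \<open>marginal\<close> (with point masses as initial laws) and \<open>markov_additive\<close>.\<close>

locale markov_semigroup =
  fixes T :: "real \<Rightarrow> ('s::topological_space \<Rightarrow> real) \<Rightarrow> 's \<Rightarrow> real"
  assumes maps_bounded_measurable:
      "\<And>t f. 0 \<le> t \<Longrightarrow> f \<in> bounded_measurable \<Longrightarrow> T t f \<in> bounded_measurable"
    and linear:
      "\<And>t a b f g. 0 \<le> t \<Longrightarrow> f \<in> bounded_measurable \<Longrightarrow> g \<in> bounded_measurable \<Longrightarrow>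
         T t (\<lambda>z. a * f z + b * g z) = (\<lambda>z. a * T t f z + b * T t g z)"
    and positive:
      "\<And>t f z. 0 \<le> t \<Longrightarrow> f \<in> bounded_measurable \<Longrightarrow> (\<And>w. 0 \<le> f w) \<Longrightarrow> 0 \<le> T t f z"
    and unital: "\<And>t. 0 \<le> t \<Longrightarrow> T t (\<lambda>_. 1) = (\<lambda>_. 1)"
    and at_zero: "\<And>f. f \<in> bounded_measurable \<Longrightarrow> T 0 f = f"
    and semigroup:
      "\<And>s t f. 0 \<le> s \<Longrightarrow> 0 \<le> t \<Longrightarrow> f \<in> bounded_measurable \<Longrightarrow> T (s + t) f = T s (T t f)"

definition feller :: "(real \<Rightarrow> ('s::topological_space \<Rightarrow> real) \<Rightarrow> 's \<Rightarrow> real) \<Rightarrow> bool" where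
  "feller T \<longleftrightarrow>
     (\<forall>f\<in>vanishing_at_infinity.
        (\<forall>t\<ge>0. T t f \<in> vanishing_at_infinity) \<and> uniform_limit UNIV (\<lambda>t. T t f) f (at_right 0))"

locale hidden_markov_model = markov_semigroup T
  for P :: "'e::polish_space measure \<Rightarrow> ('e, 'q::finite) path_space measure"
    and T :: "real \<Rightarrow> ('e \<times> (real ^ 'q) \<Rightarrow> real) \<Rightarrow> 'e \<times> (real ^ 'q) \<Rightarrow> real" +
  assumes law: "\<And>\<mu>. \<mu> \<in> borel_probs \<Longrightarrow> P \<mu> \<in> borel_probs"
    and markov:
      "\<And>\<mu> f s t. \<mu> \<in> borel_probs \<Longrightarrow> f \<in> bounded_measurable \<Longrightarrow> 0 \<le> s \<Longrightarrow> s \<le> t \<Longrightarrow>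
         AE \<omega> in completion (P \<mu>).
           real_cond_exp (completion (P \<mu>)) (augmented_filtration P s)
             (\<lambda>\<omega>. f (signal_at t \<omega>, obs_at t \<omega>)) \<omega>
           = T (t - s) f (signal_at s \<omega>, obs_at s \<omega>)"
    and marginal:
      "\<And>\<mu> f t. \<mu> \<in> borel_probs \<Longrightarrow> f \<in> bounded_measurable \<Longrightarrow> 0 \<le> t \<Longrightarrow>
         (\<integral>\<omega>. f (signal_at t \<omega>, obs_at t \<omega>) \<partial>P \<mu>) = (\<integral>x. T t f (x, 0) \<partial>\<mu>)"
    and markov_additive:
      "\<And>f t x y y'. f \<in> bounded_measurable \<Longrightarrow> 0 \<le> t \<Longrightarrow>
         T t (obs_shift y f) (x, y) = T t (obs_shift y' f) (x, y')"

definition observable ::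
    "('e::polish_space measure \<Rightarrow> ('e, 'q::finite) path_space measure) \<Rightarrow> bool" where
  "observable P \<longleftrightarrow>
     (\<forall>\<mu>\<in>borel_probs. \<forall>\<nu>\<in>borel_probs. obs_law P \<mu> = obs_law P \<nu> \<longrightarrow> \<mu> = \<nu>)"

definition uniformly_observable ::
    "('e::polish_space measure \<Rightarrow> ('e, 'q::finite) path_space measure) \<Rightarrow> bool" where
  "uniformly_observable P \<longleftrightarrow>
     (\<forall>\<mu> \<nu> :: nat \<Rightarrow> 'e measure. (\<forall>n. \<mu> n \<in> borel_probs) \<longrightarrow> (\<forall>n. \<nu> n \<in> borel_probs) \<longrightarrow>
        (\<lambda>n. tv_dist (obs_law P (\<mu> n)) (obs_law P (\<nu> n))) \<longlonglongrightarrow> 0 \<longrightarrow>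
        (\<lambda>n. bl_dist (\<mu> n) (\<nu> n)) \<longlonglongrightarrow> 0)"

end

theory Submission
  imports Defs
begin

text \<open>If uniform observability failed, some continuous \<open>p\<close> would have integrals against \<open>\<mu>\<^sub>n\<close> and \<open>\<nu>\<^sub>n\<close>
  staying apart along a subsequence; by compactness of the probability measures on \<open>E\<close> one may
  assume \<open>\<mu>\<^sub>n \<rightarrow> M\<close> and \<open>\<nu>\<^sub>n \<rightarrow> N\<close> weakly.  By the Markov property, the expectation of
  \<open>f\<^sub>1(Y\<^bsub>t1\<^esub>) \<dots> f\<^sub>k(Y\<^bsub>tk\<^esub>)\<close> is the integral over the initial law of iterated semigroup operators
  applied to the \<open>f\<^sub>i\<close>, which is a continuous function by the Feller property and therefore passes to
  the limit.  Vanishing total variation distance forces the observation laws started from \<open>M\<close> and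
  \<open>N\<close> to coincide, so \<open>M = N\<close> by observability, a contradiction.  Weak compactness is reduced to
  Helly's theorem on the real line by coding points of \<open>E\<close> as real numbers.\<close>

subsection \<open>Weak convergence on a compact space\<close>

text \<open>Observability speaks of measures on a completed sigma-field, and its uniform version
  compares them in total variation, whereas the Feller property only controls continuous functions
  vanishing at infinity. The two meet in finite products of such functions of the observations with
  every factor bounded by 1: these are admissible in the total variation supremum, their
  expectations are integrals of a continuous kernel over the initial law, and they determine the
  observation law on the raw field, hence on its completion. All limits are therefore taken over
  initial laws on E instead of over laws on path space. Only the total variation hypothesis ties
  \<open>M\<close> to \<open>N\<close>, which come from successive extractions. The coding uses base
  3 with digits 0 and 1 because distinct digit sequences then have separated values: encoding need
  not be continuous, but decoding is, and decoding is the direction in which Helly's limit has to be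
  transported.\<close>

lemma ternary_digit_separation:
  fixes b c :: "nat \<Rightarrow> real"
  assumes b: "\<And>n. b n \<in> {0, 1}" and c: "\<And>n. c n \<in> {0, 1}" and "b j \<noteq> c j"
  shows "\<exists>i\<le>j. (1/3) ^ i / 2 \<le> \<bar>(\<Sum>n. b n * (1/3) ^ n) - (\<Sum>n. c n * (1/3) ^ n)\<bar>"
proof -
  \<comment> \<open>At the first differing place the expansions part by exactly
    \<open>(1/3) ^ i\<close>; earlier digits cancel, so only the tail can work against this.\<close>
  define i where "i = (LEAST i. b i \<noteq> c i)"
  have neq: "b i \<noteq> c i" and "i \<le> j" and below: "\<And>k. k < i \<Longrightarrow> b k = c k"
    unfolding i_def using LeastI[of "\<lambda>i. b i \<noteq> c i", OF assms(3)] assms(3)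
    by (auto intro: Least_le dest: not_less_Least)
  define d where "d n = b n - c n" for n
  have d: "\<bar>d n\<bar> \<le> 1" for n
    using b[of n] c[of n] by (auto simp: d_def)
  have di: "\<bar>d i\<bar> = 1"
    using b[of i] c[of i] neq by (auto simp: d_def)
  have geo: "summable (\<lambda>n. (1/3) ^ n :: real)"
    by (simp add: summable_geometric)
  have summ: "summable (\<lambda>n. e n * (1/3) ^ n)" if "\<And>n. \<bar>e n\<bar> \<le> 1" for e :: "nat \<Rightarrow> real"
    by (rule summable_comparison_test[OF _ geo], rule exI[of _ 0])
      (use that in \<open>auto simp: abs_mult intro!: mult_left_le_one_le\<close>)
  have sb: "summable (\<lambda>n. b n * (1/3) ^ n)" and sc: "summable (\<lambda>n. c n * (1/3) ^ n)"
    and sd: "summable (\<lambda>n. d n * (1/3) ^ n)"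
    using b c d by (auto intro!: summ) (metis abs_0 abs_1 empty_iff insert_iff order_refl zero_le_one)+
  have "(\<Sum>n. b n * (1/3) ^ n) - (\<Sum>n. c n * (1/3) ^ n) = (\<Sum>n. d n * (1/3) ^ n)"
    using suminf_diff[OF sb sc] by (simp add: d_def left_diff_distrib)
  also have "\<dots> = (\<Sum>n. d (n + Suc i) * (1/3) ^ (n + Suc i)) + (\<Sum>n<Suc i. d n * (1/3) ^ n)"
    by (rule suminf_split_initial_segment[OF sd])
  also have "(\<Sum>n<Suc i. d n * (1/3) ^ n) = d i * (1/3) ^ i"
    using below by (simp add: d_def)
  finally have eq: "(\<Sum>n. b n * (1/3) ^ n) - (\<Sum>n. c n * (1/3) ^ n) =
      (\<Sum>n. d (n + Suc i) * (1/3) ^ (n + Suc i)) + d i * (1/3) ^ i" .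
  \<comment> \<open>The geometric series beyond \<open>i\<close> is half of the leading difference.
    In base 2 the tail could cancel the leading term completely.\<close>
  have "\<bar>\<Sum>n. d (n + Suc i) * (1/3) ^ (n + Suc i)\<bar> \<le> (\<Sum>n. (1/3) ^ Suc i * (1/3) ^ n :: real)"
  proof -
    have le: "norm (d (n + Suc i) * (1/3) ^ (n + Suc i)) \<le> (1/3) ^ Suc i * (1/3) ^ n" for n
    proof -
      have "\<bar>d (n + Suc i)\<bar> * (1/3) ^ (n + Suc i) \<le> 1 * (1/3) ^ (n + Suc i)"
        by (intro mult_right_mono d) simp
      then show ?thesis by (simp add: abs_mult power_add mult.commute)
    qed
    have "summable (\<lambda>n. (1/3) ^ Suc i * (1/3) ^ n :: real)"
      by (intro summable_mult geo)
    from norm_suminf_le[OF le this] show ?thesis by simp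
  qed
  also have "\<dots> = (1/3) ^ i / 2"
    by (subst suminf_mult[OF geo]) (simp add: suminf_geometric)
  finally have "(1/3) ^ i / 2 \<le> \<bar>(\<Sum>n. b n * (1/3) ^ n) - (\<Sum>n. c n * (1/3) ^ n)\<bar>"
    unfolding eq using di by (cases "d i \<ge> 0") (auto simp: abs_if split: if_splits)
  then show ?thesis using \<open>i \<le> j\<close> by blast
qed

text \<open>The code of a point lists in base 3 which basic open sets contain it; by compactness finitely
  many digits already determine the point up to \<open>\<epsilon>\<close>, so decoding is uniformly continuous.\<close>

lemma compact_real_coding:
  assumes "compact (UNIV :: 'e::polish_space set)"
  obtains s :: "'e::polish_space \<Rightarrow> real" and K and \<phi> where
    "s \<in> borel_measurable borel" "\<And>x. s x \<in> {0..2}" "closed K" "range s \<subseteq> K"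
    "continuous_on K \<phi>" "\<And>x. \<phi> (s x) = x"
proof -
  obtain \<B> :: "'e set set" where \<B>: "countable \<B>" "topological_basis \<B>"
    using ex_countable_basis by blast
  have "\<B> \<noteq> {}"
    using topological_basisE[OF \<B>(2) open_UNIV, of undefined] by blast
  define B where "B = from_nat_into \<B>"
  have range_B: "range B = \<B>"
    unfolding B_def by (rule range_from_nat_into) fact+
  have open_B: "open (B n)" for n
    using \<B>(2) range_B by (metis rangeI topological_basis_open)
  define s :: "'e \<Rightarrow> real" where "s x = (\<Sum>n. indicator (B n) x * (1/3) ^ n)" for x
  \<comment> \<open>The basic sets that fit into a ball of radius \<epsilon>/2 already cover E, so
    finitely many do, and \<open>J\<close> bounds their indices. Points with the same digits up to
    \<open>J\<close> lie together in one such set.\<close>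
  have determined: "\<exists>J. \<forall>x y. (\<forall>j\<le>J. x \<in> B j \<longleftrightarrow> y \<in> B j) \<longrightarrow> dist x y < \<epsilon>"
    if "\<epsilon> > 0" for \<epsilon>
  proof -
    define I where "I = {j. \<exists>z. B j \<subseteq> ball z (\<epsilon>/2)}"
    have "UNIV \<subseteq> (\<Union>j\<in>I. B j)"
    proof
      fix x :: 'e
      obtain b where "b \<in> \<B>" "x \<in> b" "b \<subseteq> ball x (\<epsilon>/2)"
        using topological_basisE[OF \<B>(2), of "ball x (\<epsilon>/2)" x] \<open>\<epsilon> > 0\<close> by auto
      then show "x \<in> (\<Union>j\<in>I. B j)"
        using range_B by (auto simp: I_def)
    qed
    then obtain C where C: "C \<subseteq> I" "finite C" "UNIV \<subseteq> (\<Union>j\<in>C. B j)"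
      using compactE_image[OF assms, of I B] open_B by metis
    have "dist x y < \<epsilon>" if same: "\<forall>j\<le>Max C. x \<in> B j \<longleftrightarrow> y \<in> B j" for x y
    proof -
      obtain j where j: "j \<in> C" "x \<in> B j" using C(3) by blast
      then have "y \<in> B j" using same C(2) by auto
      moreover obtain z where "B j \<subseteq> ball z (\<epsilon>/2)" using j C(1) by (auto simp: I_def)
      ultimately have "dist x z < \<epsilon>/2" "dist y z < \<epsilon>/2"
        using j by (auto simp: dist_commute subset_iff)
      then show ?thesis by (rule dist_triangle_half_l)
    qed
    then show ?thesis by blast
  qed
  \<comment> \<open>If a digit up to \<open>J\<close> differs, the first differing place is some
    \<open>i\<close> with \<open>i \<le> J\<close>, and the codes are at least
    \<open>(1/3) ^ i / 2\<close> apart.\<close>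
  have close_imp: "\<exists>\<delta>>0. \<forall>x y. \<bar>s x - s y\<bar> < \<delta> \<longrightarrow> dist x y < \<epsilon>" if "\<epsilon> > 0" for \<epsilon>
  proof -
    obtain J where J: "\<And>x y. (\<forall>j\<le>J. x \<in> B j \<longleftrightarrow> y \<in> B j) \<Longrightarrow> dist x y < \<epsilon>"
      using determined[OF \<open>\<epsilon> > 0\<close>] by blast
    have "dist x y < \<epsilon>" if "\<bar>s x - s y\<bar> < (1/3) ^ J / 2" for x y
    proof (rule J, rule ccontr)
      assume "\<not> (\<forall>j\<le>J. x \<in> B j \<longleftrightarrow> y \<in> B j)"
      then obtain j where j: "j \<le> J" "(indicator (B j) x :: real) \<noteq> indicator (B j) y"
        unfolding indicator_def by (metis zero_neq_one of_bool_eq(1) of_bool_eq(2))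
      then obtain i where "i \<le> j" "(1/3) ^ i / 2 \<le> \<bar>s x - s y\<bar>"
        using ternary_digit_separation[of "\<lambda>n. indicator (B n) x" "\<lambda>n. indicator (B n) y" j]
        by (auto simp: s_def indicator_def)
      moreover have "(1/3) ^ J \<le> ((1/3) ^ i :: real)"
        using \<open>i \<le> j\<close> j(1) by (intro power_decreasing) auto
      ultimately show False using that by linarith
    qed
    then show ?thesis by (intro exI[of _ "(1/3) ^ J / 2"]) auto
  qed
  have inj: "inj s"
  proof (rule injI, rule ccontr)
    fix x y assume "s x = s y" "x \<noteq> y"
    moreover have "dist x y > 0" using \<open>x \<noteq> y\<close> by simp
    from close_imp[OF this] obtain \<delta> where "\<delta> > 0"
      "\<And>a b. \<bar>s a - s b\<bar> < \<delta> \<Longrightarrow> dist a b < dist x y" by blast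
    ultimately show False by (metis abs_zero diff_self less_irrefl)
  qed
  \<comment> \<open>The range of \<open>s\<close> need not be closed, and a weak limit may charge
    its closure. Uniform continuity extends the decoder there, since E is complete.\<close>
  have "uniformly_continuous_on (range s) (inv s)"
    unfolding uniformly_continuous_on_def
  proof (intro allI impI)
    fix \<epsilon> :: real assume "\<epsilon> > 0"
    from close_imp[OF this] show "\<exists>\<delta>>0. \<forall>a\<in>range s. \<forall>b\<in>range s. dist b a < \<delta> \<longrightarrow> dist (inv s b) (inv s a) < \<epsilon>"
      using inj by (auto simp: dist_real_def)
  qed
  from uniformly_continuous_on_extension_on_closure[OF this]
  obtain \<phi> where \<phi>: "uniformly_continuous_on (closure (range s)) \<phi>"
    "\<And>a. a \<in> range s \<Longrightarrow> inv s a = \<phi> a" by metis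
  have geo: "summable (\<lambda>n. (1/3) ^ n :: real)"
    by (simp add: summable_geometric)
  have bound: "norm (indicator (B n) x * (1/3) ^ n :: real) \<le> (1/3) ^ n" for n x
    by (auto simp: indicator_def)
  show thesis
  proof
    show "s \<in> borel_measurable borel"
      unfolding s_def using open_B by (intro borel_measurable_suminf) measurable
    show "s x \<in> {0..2}" for x
    proof -
      have "summable (\<lambda>n. indicator (B n) x * (1/3) ^ n :: real)"
        by (rule summable_comparison_test[OF _ geo]) (use bound in auto)
      then have "0 \<le> s x"
        unfolding s_def by (intro suminf_nonneg) auto
      moreover have "norm (s x) \<le> (\<Sum>n. (1/3) ^ n)"
        unfolding s_def by (rule norm_suminf_le[OF bound geo])
      ultimately show ?thesis by (simp add: suminf_geometric)
    qed
    show "closed (closure (range s))" "range s \<subseteq> closure (range s)"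
      by (auto simp: closure_subset)
    show "continuous_on (closure (range s)) \<phi>"
      using \<phi>(1) by (rule uniformly_continuous_imp_continuous)
    show "\<phi> (s x) = x" for x
      using \<phi>(2)[of "s x"] inj by simp
  qed
qed

lemma continuous_on_compact_UNIV_bounded:
  fixes f :: "'e::topological_space \<Rightarrow> real"
  assumes "compact (UNIV :: 'e set)" "continuous_on UNIV f"
  obtains C where "0 \<le> C" "\<And>x. \<bar>f x\<bar> \<le> C"
proof -
  have "bounded (range f)"
    by (intro compact_imp_bounded compact_continuous_image assms)
  then obtain C where "\<And>x. \<bar>f x\<bar> \<le> C" by (auto simp: bounded_iff)
  moreover from this have "0 \<le> C" by (metis abs_ge_zero order_trans)
  ultimately show thesis using that by blast
qed

lemma integrable_continuous_compact_UNIV: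
  fixes f :: "'e::topological_space \<Rightarrow> real"
  assumes "compact (UNIV :: 'e set)" "continuous_on UNIV f" "\<mu> \<in> borel_probs"
  shows "integrable \<mu> f"
proof -
  obtain C where "\<And>x. \<bar>f x\<bar> \<le> C"
    using continuous_on_compact_UNIV_bounded assms by metis
  moreover have "prob_space \<mu>" "sets \<mu> = sets borel"
    using assms(3) by (auto simp: space_prob_algebra)
  ultimately show ?thesis
    using assms(2) borel_measurable_continuous_onI[of f] measurable_cong_sets[of \<mu> borel]
    by (intro finite_measure.integrable_const_bound[where B = C])
      (auto simp: prob_space.finite_measure)
qed

text \<open>The coded laws live on a bounded interval and are therefore tight. The limit
  \<open>L\<close> on the line need not be carried by codes of points, but it is carried by the
  closed set \<open>K\<close>, where decoding makes sense. Although \<open>s\<close> need not be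
  continuous, each continuous \<open>f\<close> on E factors as \<open>h (s x)\<close> with
  \<open>h\<close> continuous on the whole line, so weak convergence on the line is enough.\<close>

lemma borel_probs_sequentially_compact:
  fixes \<mu> :: "nat \<Rightarrow> 'e::polish_space measure"
  assumes comp: "compact (UNIV :: 'e set)" and \<mu>: "\<And>n. \<mu> n \<in> borel_probs"
  obtains r M where "strict_mono (r :: nat \<Rightarrow> nat)" "M \<in> borel_probs"
    "\<And>f :: 'e \<Rightarrow> real. continuous_on UNIV f \<Longrightarrow>
      (\<lambda>n. \<integral>x. f x \<partial>\<mu> (r n)) \<longlonglongrightarrow> (\<integral>x. f x \<partial>M)"
proof -
  obtain s :: "'e \<Rightarrow> real" and K \<phi> where s: "s \<in> borel_measurable borel" "\<And>x. s x \<in> {0..2}"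
    and K: "closed K" "range s \<subseteq> K" and \<phi>: "continuous_on K \<phi>" "\<And>x. \<phi> (s x) = x"
    using compact_real_coding[OF comp] by metis
  define \<rho> where "\<rho> n = distr (\<mu> n) borel s" for n
  have prob_\<mu>: "prob_space (\<mu> n)" and sets_\<mu>[measurable_cong]: "sets (\<mu> n) = sets borel" for n
    using \<mu>[of n] by (auto simp: space_prob_algebra)
  have s_meas[measurable]: "s \<in> \<mu> n \<rightarrow>\<^sub>M borel" for n
    using s(1) by measurable
  have dist_\<rho>: "real_distribution (\<rho> n)" for n
    unfolding \<rho>_def by (intro prob_space.real_distribution_distr prob_\<mu> s_meas)
  \<comment> \<open>Tightness is phrased with half-open intervals; the left end lies below 0 so that
    the code 0 is included.\<close>
  have "measure (\<rho> n) {-1<..2} = 1" for n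
  proof -
    have "s -` {-1<..2} \<inter> space (\<mu> n) = space (\<mu> n)"
      using s(2) by (force simp: sets_eq_imp_space_eq[OF sets_\<mu>])
    then show ?thesis
      unfolding \<rho>_def by (subst measure_distr) (auto simp: prob_space.prob_space[OF prob_\<mu>])
  qed
  then have "tight \<rho>"
    using dist_\<rho> unfolding tight_def
    by (intro conjI allI impI exI[of _ "-1::real"] exI[of _ "2::real"]) auto
  from tight_imp_convergent_subsubsequence[OF this strict_mono_id]
  obtain r L where r: "strict_mono r" and L: "real_distribution L" and conv: "weak_conv_m (\<rho> \<circ> id \<circ> r) L"
    by blast
  interpret L: real_distribution L by fact
  have conv_int: "(\<lambda>n. \<integral>x. h (s x) \<partial>\<mu> (r n)) \<longlonglongrightarrow> (\<integral>x. h x \<partial>L)"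
    if h: "continuous_on UNIV h" "\<And>x. \<bar>h x\<bar> \<le> C" for h :: "real \<Rightarrow> real" and C
  proof -
    have "(\<lambda>n. \<integral>x. h x \<partial>((\<rho> \<circ> id \<circ> r) n)) \<longlonglongrightarrow> (\<integral>x. h x \<partial>L)"
      using h by (intro weak_conv_imp_integral_bdd_continuous_conv[OF _ L conv])
        (auto simp: dist_\<rho> continuous_on_eq_continuous_at)
    moreover have "h \<in> borel_measurable borel"
      using h(1) by (rule borel_measurable_continuous_onI)
    ultimately show ?thesis
      by (simp add: \<rho>_def integral_distr s_meas)
  qed
  have "range s \<noteq> {}" by blast
  then have "K \<noteq> {}" using K(2) by blast
  \<comment> \<open>A bounded continuous function whose zero set is exactly \<open>K\<close>. Its
    integral vanishes along the sequence, hence also for \<open>L\<close>, which puts full mass on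
    \<open>K\<close>.\<close>
  define g where "g a = min 1 (infdist a K)" for a
  have g: "continuous_on UNIV g" "0 \<le> g a" "g a \<le> 1" for a
    unfolding g_def by (auto intro!: continuous_intros infdist_nonneg)
  have "(\<lambda>n. \<integral>x. g (s x) \<partial>\<mu> (r n)) \<longlonglongrightarrow> (\<integral>x. g x \<partial>L)"
    using g by (intro conv_int[of _ 1]) auto
  moreover have "g (s x) = 0" for x
    using K(2) by (auto simp: g_def image_subset_iff)
  ultimately have "(\<integral>x. g x \<partial>L) = 0"
    by (simp add: LIMSEQ_const_iff)
  moreover have "integrable L g"
    using g borel_measurable_continuous_onI[OF g(1)]
    by (intro L.integrable_const_bound[where B = 1]) auto
  ultimately have "AE a in L. g a = 0"
    using integral_nonneg_eq_0_iff_AE[of L g] g(2) by auto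
  moreover have "a \<in> K" if "g a = 0" for a
    using that \<open>K \<noteq> {}\<close> K(1) by (auto simp: g_def in_closed_iff_infdist_zero min_def split: if_splits)
  ultimately have inK: "AE a in L. a \<in> K" by auto
  \<comment> \<open>The decoder is continuous on \<open>K\<close> only. The default value elsewhere
    keeps it Borel, because \<open>K\<close> is closed, and is met with \<open>L\<close>-probability
    0.\<close>
  define \<psi> where "\<psi> a = (if a \<in> K then \<phi> a else undefined)" for a
  have \<psi>_meas: "\<psi> \<in> borel_measurable borel"
    unfolding \<psi>_def using K(1) \<phi>(1) by (intro borel_measurable_continuous_on_if) auto
  define M where "M = distr L borel \<psi>"
  show thesis
  proof
    show "strict_mono r" by fact
    show "M \<in> borel_probs"
      using \<psi>_meas by (auto simp: M_def space_prob_algebra intro!: L.prob_space_distr)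
    fix f :: "'e \<Rightarrow> real" assume f: "continuous_on UNIV f"
    obtain C where C: "0 \<le> C" "\<And>x. \<bar>f x\<bar> \<le> C"
      using continuous_on_compact_UNIV_bounded comp f by metis
    \<comment> \<open>Tietze supplies the factor \<open>h\<close>, with the bound of
      \<open>f\<close> preserved so that it is an admissible test function on the line.\<close>
    have "continuous_on K (\<lambda>a. f (\<phi> a))"
      using continuous_on_compose2[OF f \<phi>(1)] by auto
    then obtain h where h: "continuous_on UNIV h" "\<And>a. a \<in> K \<Longrightarrow> h a = f (\<phi> a)" "\<And>a. norm (h a) \<le> C"
      using Tietze[of K "\<lambda>a. f (\<phi> a)" UNIV C] K(1) C by auto
    have "h (s x) = f x" for x
      using h(2)[of "s x"] K(2) \<phi>(2) by auto
    then have "(\<lambda>n. \<integral>x. f x \<partial>\<mu> (r n)) \<longlonglongrightarrow> (\<integral>x. h x \<partial>L)"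
      using conv_int[OF h(1), of C] h(3) by auto
    also have "(\<integral>x. h x \<partial>L) = (\<integral>x. f (\<psi> x) \<partial>L)"
    proof (rule integral_cong_AE)
      show "AE a in L. h a = f (\<psi> a)"
        using inK by eventually_elim (simp add: h(2) \<psi>_def)
      show "h \<in> borel_measurable L"
        using borel_measurable_continuous_onI[OF h(1)] by simp
      show "(\<lambda>a. f (\<psi> a)) \<in> borel_measurable L"
        using measurable_compose[OF \<psi>_meas borel_measurable_continuous_onI[OF f]] by simp
    qed
    also have "\<dots> = (\<integral>x. f x \<partial>M)"
      unfolding M_def using \<psi>_meas borel_measurable_continuous_onI[OF f]
      by (subst integral_distr) auto
    finally show "(\<lambda>n. \<integral>x. f x \<partial>\<mu> (r n)) \<longlonglongrightarrow> (\<integral>x. f x \<partial>M)" .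
  qed
qed

section \<open>Bounded Lipschitz distance through finitely many test functions\<close>

lemma compact_partition_of_unity:
  assumes "compact (UNIV :: 'e::metric_space set)" "\<delta> > 0"
  obtains C :: "'e::metric_space set" and p :: "'e \<Rightarrow> 'e \<Rightarrow> real" where
    "finite C" "\<And>c. c \<in> C \<Longrightarrow> continuous_on UNIV (p c)" "\<And>c x. 0 \<le> p c x"
    "\<And>x. (\<Sum>c\<in>C. p c x) = 1" "\<And>c x. p c x \<noteq> 0 \<Longrightarrow> dist x c < \<delta>"
proof -
  obtain C :: "'e set" where C: "finite C" "UNIV \<subseteq> (\<Union>c\<in>C. ball c \<delta>)"
  proof -
    have "UNIV \<subseteq> (\<Union>c::'e. ball c \<delta>)"
      using assms(2) by (auto intro: centre_in_ball[THEN iffD2])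
    then show thesis
      using compactE_image[OF assms(1), of UNIV "\<lambda>c. ball c \<delta>"] that by (metis open_ball)
  qed
  \<comment> \<open>Tent functions over a finite \<delta>-net. Every point lies in some ball of the
    net, so their sum is positive and one may normalise by it.\<close>
  define h where "h c x = max 0 (\<delta> - dist x c)" for c x :: 'e
  have pos: "(\<Sum>c\<in>C. h c x) > 0" for x
  proof -
    obtain c where "c \<in> C" "dist x c < \<delta>"
      using C(2) by (force simp: dist_commute)
    then show ?thesis
      using C(1) by (intro sum_pos2[of C c]) (auto simp: h_def)
  qed
  show thesis
  proof
    show "finite C" by fact
    show "continuous_on UNIV (\<lambda>x. h c x / (\<Sum>c\<in>C. h c x))" for c
      using pos unfolding h_def by (intro continuous_intros) (auto simp: less_imp_neq[symmetric])
    show "0 \<le> h c x / (\<Sum>c\<in>C. h c x)" for c x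
      using pos[of x] by (auto simp: h_def)
    show "(\<Sum>c\<in>C. h c x / (\<Sum>c\<in>C. h c x)) = 1" for x
      using pos[of x] by (simp add: sum_divide_distrib[symmetric])
    show "dist x c < \<delta>" if "h c x / (\<Sum>c\<in>C. h c x) \<noteq> 0" for c x
      using that by (auto simp: h_def max_def split: if_splits)
  qed
qed

text \<open>Every function of the Lipschitz class is within \<delta> of its interpolation
  \<open>\<Sum>c\<in>C. f c * p c x\<close>, whose coefficients are bounded by 1. The whole supremum
  is thus controlled by the finitely many integrals of the \<open>p c\<close>, uniformly in
  \<open>f\<close>.\<close>

lemma bl_dist_tendsto_zero:
  fixes \<mu> \<nu> :: "nat \<Rightarrow> 'e::metric_space measure"
  assumes comp: "compact (UNIV :: 'e set)"
    and \<mu>: "\<And>n. \<mu> n \<in> borel_probs" and \<nu>: "\<And>n. \<nu> n \<in> borel_probs"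
    and conv: "\<And>p :: 'e \<Rightarrow> real. continuous_on UNIV p \<Longrightarrow>
      (\<lambda>n. (\<integral>x. p x \<partial>\<mu> n) - (\<integral>x. p x \<partial>\<nu> n)) \<longlonglongrightarrow> 0"
  shows "(\<lambda>n. bl_dist (\<mu> n) (\<nu> n)) \<longlonglongrightarrow> 0"
proof (rule tendstoI)
  fix \<epsilon> :: real assume "\<epsilon> > 0"
  \<comment> \<open>The final bound is \<open>2 * \<delta> + S n\<close>: one \<delta> for each
    measure, and \<open>S n\<close> eventually less than a third one.\<close>
  define \<delta> where "\<delta> = \<epsilon> / 4"
  have "\<delta> > 0" using \<open>\<epsilon> > 0\<close> by (simp add: \<delta>_def)
  obtain C :: "'e set" and p where C: "finite C"
    and p: "\<And>c. c \<in> C \<Longrightarrow> continuous_on UNIV (p c)" "\<And>c x. 0 \<le> p c x"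
    "\<And>x. (\<Sum>c\<in>C. p c x) = (1::real)" "\<And>c x. p c x \<noteq> 0 \<Longrightarrow> dist x c < \<delta>"
    using compact_partition_of_unity[OF comp \<open>\<delta> > 0\<close>] by metis
  define S where "S n = (\<Sum>c\<in>C. \<bar>(\<integral>x. p c x \<partial>\<mu> n) - (\<integral>x. p c x \<partial>\<nu> n)\<bar>)" for n
  let ?F = "{f :: 'e \<Rightarrow> real. (\<forall>x. \<bar>f x\<bar> \<le> 1) \<and> 1-lipschitz_on UNIV f}"
  have bound: "\<bar>(\<integral>x. f x \<partial>\<mu> n) - (\<integral>x. f x \<partial>\<nu> n)\<bar> \<le> 2 * \<delta> + S n" if f: "f \<in> ?F" for f n
  proof -
    define g where "g x = (\<Sum>c\<in>C. f c * p c x)" for x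
    have f_cont: "continuous_on UNIV f"
      using f by (auto intro: lipschitz_on_continuous_on)
    have g_cont: "continuous_on UNIV g"
      unfolding g_def using p(1) by (intro continuous_intros) auto
    \<comment> \<open>Only centres within \<delta> of \<open>x\<close> carry weight, and there the
      Lipschitz bound applies.\<close>
    have fg: "\<bar>f x - g x\<bar> \<le> \<delta>" for x
    proof -
      have "f x - g x = (\<Sum>c\<in>C. (f x - f c) * p c x)"
        by (simp add: g_def left_diff_distrib sum_subtractf sum_distrib_left[symmetric] p(3))
      also have "\<bar>\<dots>\<bar> \<le> (\<Sum>c\<in>C. \<delta> * p c x)"
      proof (rule order_trans[OF sum_abs], rule sum_mono)
        fix c assume "c \<in> C"
        show "\<bar>(f x - f c) * p c x\<bar> \<le> \<delta> * p c x"
        proof (cases "p c x = 0")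
          case False
          then have "dist x c < \<delta>" by (rule p(4))
          moreover have "dist (f x) (f c) \<le> dist x c"
            using f lipschitz_onD[of 1 UNIV f x c] by simp
          ultimately show ?thesis
            using p(2)[of c x] by (auto simp: abs_mult dist_real_def intro!: mult_right_mono)
        qed simp
      qed
      also have "\<dots> = \<delta>" by (simp add: sum_distrib_left[symmetric] p(3))
      finally show ?thesis .
    qed
    have approx: "\<bar>(\<integral>x. f x \<partial>M) - (\<Sum>c\<in>C. f c * (\<integral>x. p c x \<partial>M))\<bar> \<le> \<delta>" if M: "M \<in> borel_probs" for M
    proof -
      interpret prob_space M using M by (simp add: space_prob_algebra)
      have int: "integrable M k" if "continuous_on UNIV k" for k :: "'e \<Rightarrow> real"
        using integrable_continuous_compact_UNIV comp that M by blast
      have "(\<Sum>c\<in>C. f c * (\<integral>x. p c x \<partial>M)) = (\<integral>x. g x \<partial>M)"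
        unfolding g_def using p(1) by (subst Bochner_Integration.integral_sum) (auto intro: int)
      then have "(\<integral>x. f x \<partial>M) - (\<Sum>c\<in>C. f c * (\<integral>x. p c x \<partial>M)) = (\<integral>x. f x - g x \<partial>M)"
        using int f_cont g_cont by simp
      also have "\<bar>\<dots>\<bar> \<le> (\<integral>x. \<bar>f x - g x\<bar> \<partial>M)" by (rule integral_abs_bound)
      also have "\<dots> \<le> \<delta>"
        using fg int f_cont g_cont by (intro integral_le_const AE_I2) auto
      finally show ?thesis .
    qed
    have "\<bar>(\<Sum>c\<in>C. f c * (\<integral>x. p c x \<partial>\<mu> n)) - (\<Sum>c\<in>C. f c * (\<integral>x. p c x \<partial>\<nu> n))\<bar> \<le> S n"
      unfolding S_def sum_subtractf[symmetric] right_diff_distrib[symmetric]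
      using f by (intro order_trans[OF sum_abs] sum_mono) (auto simp: abs_mult intro!: mult_left_le_one_le)
    then show ?thesis using approx[OF \<mu>, of n] approx[OF \<nu>, of n] by linarith
  qed
  have zero: "(\<lambda>_. 0) \<in> ?F" by (auto simp: lipschitz_on_def)
  have bl_le: "bl_dist (\<mu> n) (\<nu> n) \<le> 2 * \<delta> + S n" for n
    unfolding bl_dist_def
  proof (rule cSUP_least)
    show "?F \<noteq> {}" using zero by (metis empty_iff)
  qed (rule bound)
  have bl_nonneg: "0 \<le> bl_dist (\<mu> n) (\<nu> n)" for n
    unfolding bl_dist_def
  proof (rule cSUP_upper2[OF _ zero])
    show "bdd_above ((\<lambda>f. \<bar>(\<integral>x. f x \<partial>\<mu> n) - (\<integral>x. f x \<partial>\<nu> n)\<bar>) ` ?F)"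
      using bound by (intro bdd_aboveI2) blast
  qed simp
  have "S \<longlonglongrightarrow> 0"
    unfolding S_def using p(1) by (intro tendsto_null_sum tendsto_rabs_zero conv)
  then have "\<forall>\<^sub>F n in sequentially. S n < \<delta>"
    using \<open>\<delta> > 0\<close> by (rule order_tendstoD)
  then show "\<forall>\<^sub>F n in sequentially. dist (bl_dist (\<mu> n) (\<nu> n)) 0 < \<epsilon>"
  proof eventually_elim
    case (elim n)
    then show ?case using bl_le[of n] bl_nonneg[of n] \<open>\<epsilon> > 0\<close> by (simp add: \<delta>_def)
  qed
qed

subsection \<open>Measurability on path space\<close>

lemma path_at_right_continuous:
  "0 \<le> t \<Longrightarrow> (path_at x \<longlongrightarrow> path_at x t) (at_right t)"
  using path_at[of x] by (simp add: is_cadlag_def)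

text \<open>Evaluation at a fixed time is in general not continuous for the Skorokhod topology, but
  visits during an open time interval are stable: the time change moves the visiting time from
  \<open>s\<close> to the nearby \<open>l n s\<close>, which stays in the interval
  eventually.\<close>

lemma open_cadlag_visits:
  fixes U :: "'a::metric_space set"
  assumes "open U" "0 \<le> a"
  shows "open {x :: 'a cadlag. \<exists>s\<in>{a<..<b}. path_at x s \<in> U}"
  unfolding open_cadlag_def
proof (intro ballI allI impI)
  fix x :: "'a cadlag" and xs
  assume "x \<in> {x. \<exists>s\<in>{a<..<b}. path_at x s \<in> U}" and "skorokhod_tendsto xs x"
  then obtain s l where s: "a < s" "s < b" "path_at x s \<in> U"
    and l: "uniform_limit {0..} l (\<lambda>t. t) sequentially"
    and xs: "\<And>N::nat. uniform_limit {0..real N} (\<lambda>n t. path_at (xs n) (l n t)) (path_at x) sequentially"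
    unfolding skorokhod_tendsto_def by auto
  have "(\<lambda>n. l n s) \<longlonglongrightarrow> s"
    using tendsto_uniform_limitI[OF l] s assms(2) by auto
  then have 1: "\<forall>\<^sub>F n in sequentially. l n s \<in> {a<..<b}"
    using s by (intro topological_tendstoD) auto
  obtain N :: nat where "s \<le> real N" using real_arch_simple by blast
  then have "(\<lambda>n. path_at (xs n) (l n s)) \<longlonglongrightarrow> path_at x s"
    using tendsto_uniform_limitI[OF xs[of N]] s assms(2) by auto
  then have 2: "\<forall>\<^sub>F n in sequentially. path_at (xs n) (l n s) \<in> U"
    using s assms(1) by (intro topological_tendstoD)
  from 1 2 show "\<forall>\<^sub>F n in sequentially. xs n \<in> {x. \<exists>s\<in>{a<..<b}. path_at x s \<in> U}"
    by eventually_elim blast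
qed

lemma borel_measurableI_closed:
  fixes f :: "'a \<Rightarrow> 'b::topological_space"
  assumes "\<And>C. closed C \<Longrightarrow> f -` C \<inter> space M \<in> sets M"
  shows "f \<in> borel_measurable M"
  unfolding borel_eq_closed using assms by (intro measurable_measure_of) auto

text \<open>By right continuity \<open>x t \<in> C\<close> means that just after \<open>t\<close> the path stays within every
  distance of \<open>C\<close>, and the failure of this is a countable combination of the open visiting events.\<close>

lemma measurable_path_at:
  fixes t :: real
  assumes "0 \<le> t"
  shows "(\<lambda>x :: 'a::metric_space cadlag. path_at x t) \<in> borel \<rightarrow>\<^sub>M borel"
proof (rule borel_measurableI_closed)
  fix C :: "'a set" assume "closed C"
  show "(\<lambda>x. path_at x t) -` C \<inter> space borel \<in> sets borel"
  \<comment> \<open>By convention \<open>infdist\<close> to the empty set is 0, so the description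
    of \<open>C\<close> by distances needs it nonempty.\<close>
  proof (cases "C = {}")
    case False
    define U where "U k = {y. 1 / Suc k < infdist y C}" for k :: nat
    define V where "V k m = {x. \<exists>s\<in>{t<..<t + 1 / Suc m}. path_at x s \<in> U k}" for k m :: nat
    have "open (U k)" for k
      unfolding U_def by (intro open_Collect_less continuous_intros)
    then have V: "V k m \<in> sets borel" for k m
      unfolding V_def using assms by (intro borel_open open_cadlag_visits)
    have "path_at x t \<in> C \<longleftrightarrow> (\<forall>k. \<exists>m. x \<notin> V k m)" for x
    proof
      assume in_C: "path_at x t \<in> C"
      show "\<forall>k. \<exists>m. x \<notin> V k m"
      proof
        fix k :: nat
        have "((\<lambda>s. infdist (path_at x s) C) \<longlongrightarrow> infdist (path_at x t) C) (at_right t)"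
          by (intro tendsto_infdist path_at_right_continuous assms)
        then have "\<forall>\<^sub>F s in at_right t. infdist (path_at x s) C < 1 / Suc k"
          using in_C by (intro order_tendstoD(2)) auto
        then obtain b where b: "b > t" "\<And>s. t < s \<Longrightarrow> s < b \<Longrightarrow> infdist (path_at x s) C < 1 / Suc k"
          unfolding eventually_at_right_field by blast
        obtain m :: nat where "1 / Suc m < b - t"
          using b(1) nat_approx_posE[of "b - t"] by auto
        then have "x \<notin> V k m"
          using b(2) by (force simp: V_def U_def)
        then show "\<exists>m. x \<notin> V k m" ..
      qed
    next
      assume *: "\<forall>k. \<exists>m. x \<notin> V k m"
      have lim: "((\<lambda>s. infdist (path_at x s) C) \<longlongrightarrow> infdist (path_at x t) C) (at_right t)"
        by (intro tendsto_infdist path_at_right_continuous assms)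
      have le: "infdist (path_at x t) C \<le> 1 / Suc k" for k
      proof -
        obtain m where m: "x \<notin> V k m" using * by blast
        have "\<forall>\<^sub>F s in at_right t. infdist (path_at x s) C \<le> 1 / Suc k"
          unfolding eventually_at_right_field
          using m by (intro exI[of _ "t + 1 / Suc m"]) (force simp: V_def U_def not_less)
        then show ?thesis by (rule tendsto_upperbound[OF lim]) simp
      qed
      have "infdist (path_at x t) C \<le> 0"
      proof (rule ccontr)
        assume "\<not> ?thesis"
        then obtain k :: nat where "1 / Suc k < infdist (path_at x t) C"
          using nat_approx_posE[of "infdist (path_at x t) C"] by auto
        then show False using le[of k] by simp
      qed
      then have "infdist (path_at x t) C = 0"
        using infdist_nonneg[of "path_at x t" C] by linarith
      then show "path_at x t \<in> C"
        using \<open>closed C\<close> False by (simp add: in_closed_iff_infdist_zero)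
    qed
    then have "(\<lambda>x. path_at x t) -` C \<inter> space borel = (\<Inter>k. \<Union>m. UNIV - V k m)"
      by auto
    then show ?thesis
      using V by (auto intro!: sets.countable_INT sets.countable_UN)
  qed simp
qed

lemma measurable_signal_at:
  "0 \<le> t \<Longrightarrow> (signal_at t :: ('e::polish_space, 'q::finite) path_space \<Rightarrow> 'e) \<in> borel \<rightarrow>\<^sub>M borel"
  unfolding signal_at_def[abs_def]
  by (intro measurable_compose[OF _ measurable_path_at] borel_measurable_continuous_onI)
    (auto intro: continuous_intros)

lemma measurable_obs_at:
  "0 \<le> t \<Longrightarrow> (obs_at t :: ('e::polish_space, 'q::finite) path_space \<Rightarrow> real ^ 'q) \<in> borel \<rightarrow>\<^sub>M borel"
  unfolding obs_at_def[abs_def]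
  by (intro measurable_compose[OF _ measurable_path_at] borel_measurable_continuous_onI)
    (auto intro: continuous_intros)

section \<open>Raw and augmented sigma-fields on path space\<close>

lemma sigma_algebra_sets_UNIV: "space M = UNIV \<Longrightarrow> sigma_algebra UNIV (sets M)"
  using sets.sigma_algebra_axioms[of M] by simp

lemma space_borel_probs: "\<mu> \<in> borel_probs \<Longrightarrow> space \<mu> = UNIV"
  using sets_eq_imp_space_eq[of \<mu> borel] by (auto simp: space_prob_algebra)

lemma sets_raw_signal_filtration: "sets (raw_signal_filtration t) =
    sigma_sets UNIV {signal_at s -` A | s A. 0 \<le> s \<and> s \<le> t \<and> A \<in> sets borel}"
  unfolding raw_signal_filtration_def by (auto intro!: sets_measure_of)

lemma sets_raw_obs_filtration: "sets (raw_obs_filtration t) =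
    sigma_sets UNIV {obs_at s -` A | s A. 0 \<le> s \<and> s \<le> t \<and> A \<in> sets borel}"
  unfolding raw_obs_filtration_def by (auto intro!: sets_measure_of)

lemma space_raw_filtration: "space (raw_filtration t) = UNIV"
  and sets_raw_filtration: "sets (raw_filtration t) =
    sigma_sets UNIV (sets (raw_signal_filtration t) \<union> sets (raw_obs_filtration t))"
  unfolding raw_filtration_def by (auto simp: space_measure_of_conv intro!: sets_measure_of)

lemma space_raw_obs_field: "space raw_obs_field = UNIV"
  and sets_raw_obs_field: "sets raw_obs_field =
    sigma_sets UNIV (\<Union>t\<in>{0..}. sets (raw_obs_filtration t))"
  unfolding raw_obs_field_def by (auto simp: space_measure_of_conv intro!: sets_measure_of)

lemma vimage_sets_borel:
  "f \<in> borel \<rightarrow>\<^sub>M borel \<Longrightarrow> A \<in> sets borel \<Longrightarrow> f -` A \<in> sets borel"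
  using measurable_sets[of f borel borel A] by simp

lemma raw_obs_filtration_subset_borel: "sets (raw_obs_filtration t) \<subseteq> sets borel"
  unfolding sets_raw_obs_filtration
  by (intro sigma_algebra.sigma_sets_subset sigma_algebra_sets_UNIV)
    (auto intro: vimage_sets_borel measurable_obs_at)

lemma raw_signal_filtration_subset_borel: "sets (raw_signal_filtration t) \<subseteq> sets borel"
  unfolding sets_raw_signal_filtration
  by (intro sigma_algebra.sigma_sets_subset sigma_algebra_sets_UNIV)
    (auto intro: vimage_sets_borel measurable_signal_at)

lemma raw_filtration_subset_borel: "sets (raw_filtration t) \<subseteq> sets borel"
  unfolding sets_raw_filtration
  by (intro sigma_algebra.sigma_sets_subset sigma_algebra_sets_UNIV Un_least
      raw_obs_filtration_subset_borel raw_signal_filtration_subset_borel) simp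

lemma raw_obs_field_subset_borel: "sets raw_obs_field \<subseteq> sets borel"
  unfolding sets_raw_obs_field
  by (intro sigma_algebra.sigma_sets_subset sigma_algebra_sets_UNIV UN_least
      raw_obs_filtration_subset_borel) simp

lemma measurable_obs_at_raw_obs_field: "0 \<le> t \<Longrightarrow> obs_at t \<in> raw_obs_field \<rightarrow>\<^sub>M borel"
proof (rule measurableI)
  fix A :: "(real ^ 'b) set" assume "0 \<le> t" "A \<in> sets borel"
  then have "obs_at t -` A \<in> sets (raw_obs_filtration t)"
    unfolding sets_raw_obs_filtration by (intro sigma_sets.Basic) auto
  then show "obs_at t -` A \<inter> space raw_obs_field \<in> sets raw_obs_field"
    using \<open>0 \<le> t\<close> by (auto simp: space_raw_obs_field sets_raw_obs_field intro!: sigma_sets.Basic)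
qed auto

lemma measurable_obs_at_raw_filtration:
  assumes "0 \<le> s" "s \<le> t"
  shows "obs_at s \<in> raw_filtration t \<rightarrow>\<^sub>M borel"
proof (rule measurableI)
  fix A :: "(real ^ 'b) set" assume "A \<in> sets borel"
  then have "obs_at s -` A \<in> sets (raw_obs_filtration t)"
    unfolding sets_raw_obs_filtration using assms by (intro sigma_sets.Basic) auto
  then show "obs_at s -` A \<inter> space (raw_filtration t) \<in> sets (raw_filtration t)"
    by (auto simp: space_raw_filtration sets_raw_filtration intro!: sigma_sets.Basic)
qed auto

lemma raw_filtration_mono: "s \<le> t \<Longrightarrow> sets (raw_filtration s) \<subseteq> sets (raw_filtration t)"
  unfolding sets_raw_filtration sets_raw_signal_filtration sets_raw_obs_filtration
  by (intro sigma_sets_mono' Un_mono) force+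

lemma sets_augmented_filtration:
  "sets (augmented_filtration P t) = sigma_sets UNIV (\<Inter>\<mu>\<in>borel_probs. \<Inter>u\<in>{t<..}.
     sigma_sets UNIV (sets (raw_filtration u) \<union> null_sets (completion (P \<mu>))))"
  and space_augmented_filtration: "space (augmented_filtration P t) = UNIV"
  unfolding augmented_filtration_def by (auto simp: space_measure_of_conv intro!: sets_measure_of)

lemma raw_filtration_subset_augmented: "sets (raw_filtration t) \<subseteq> sets (augmented_filtration P t)"
proof
  fix A :: "('a, 'b) path_space set" assume "A \<in> sets (raw_filtration t)"
  then have "A \<in> sets (raw_filtration u)" if "t < u" for u
    using raw_filtration_mono[of t u] that by auto
  then show "A \<in> sets (augmented_filtration P t)"
    unfolding sets_augmented_filtration by (intro sigma_sets.Basic INT_I) auto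
qed

text \<open>This makes \<open>real_cond_exp\<close> in the Markov property a genuine conditional
  expectation. One member \<mu> of the family and one later time, here \<open>t + 1\<close>, already
  bound the intersection defining the augmentation.\<close>

lemma subalgebra_augmented_filtration:
  assumes "\<mu> \<in> borel_probs" "P \<mu> \<in> borel_probs"
  shows "subalgebra (completion (P \<mu>)) (augmented_filtration P t)"
proof -
  have sp: "space (completion (P \<mu>)) = UNIV"
    using space_borel_probs[OF assms(2)] by simp
  note sa = sigma_algebra_sets_UNIV[OF sp]
  have "sets (P \<mu>) = sets borel"
    using assms(2) by (simp add: space_prob_algebra)
  then have "sets (raw_filtration (t + 1)) \<union> null_sets (completion (P \<mu>)) \<subseteq> sets (completion (P \<mu>))"
    using raw_filtration_subset_borel by (fastforce dest: null_setsD2)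
  then have "sigma_sets UNIV (sets (raw_filtration (t + 1)) \<union> null_sets (completion (P \<mu>)))
      \<subseteq> sets (completion (P \<mu>))"
    by (rule sigma_algebra.sigma_sets_subset[OF sa])
  then have "sets (augmented_filtration P t) \<subseteq> sets (completion (P \<mu>))"
    unfolding sets_augmented_filtration using assms(1)
    by (intro sigma_algebra.sigma_sets_subset[OF sa] order_trans[OF INF_lower[OF assms(1)]]
        INF_lower2[of "t + 1"]) auto
  then show ?thesis
    by (simp only: subalgebra_def sp space_augmented_filtration simp_thms)
qed

section \<open>The completed observation field and the laws on it\<close>

lemma sets_obs_field:
  "sets (obs_field P) =
     sigma_sets UNIV (\<Inter>\<mu>\<in>borel_probs. sets (completion (restr_to_subalg (P \<mu>) raw_obs_field)))"
  and space_obs_field: "space (obs_field P) = UNIV"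
  unfolding obs_field_def by (auto simp: space_measure_of_conv intro!: sets_measure_of)

lemma subalgebra_raw_obs_field: "M \<in> borel_probs \<Longrightarrow> subalgebra M raw_obs_field"
  using raw_obs_field_subset_borel
  by (auto simp: subalgebra_def space_raw_obs_field space_borel_probs space_prob_algebra)

lemma raw_obs_field_subset_obs_field:
  assumes "\<And>\<mu>. \<mu> \<in> borel_probs \<Longrightarrow> P \<mu> \<in> borel_probs"
  shows "sets raw_obs_field \<subseteq> sets (obs_field P)"
proof
  fix A :: "('a, 'b) path_space set" assume "A \<in> sets raw_obs_field"
  then have "A \<in> sets (completion (restr_to_subalg (P \<mu>) raw_obs_field))" if "\<mu> \<in> borel_probs" for \<mu>
    using sets_restr_to_subalg[OF subalgebra_raw_obs_field[OF assms[OF that]]] by auto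
  then show "A \<in> sets (obs_field P)"
    unfolding sets_obs_field by (intro sigma_sets.Basic) auto
qed

lemma obs_field_subset:
  assumes "\<mu> \<in> borel_probs" "P \<mu> \<in> borel_probs"
  shows "sets (obs_field P) \<subseteq> sets (completion (restr_to_subalg (P \<mu>) raw_obs_field))"
  unfolding sets_obs_field
  by (intro sigma_algebra.sigma_sets_subset sigma_algebra_sets_UNIV INF_lower[OF assms(1)])
    (simp add: space_restr_to_subalg space_borel_probs assms)

text \<open>Null sets of the restricted law are null for the full law, so completing on the smaller
  field stays inside the completion on the larger one.\<close>

lemma subalgebra_obs_field:
  assumes "\<mu> \<in> borel_probs" "P \<mu> \<in> borel_probs"
  shows "subalgebra (completion (P \<mu>)) (obs_field P)"
proof -
  note sub = subalgebra_raw_obs_field[OF assms(2)]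
  have "sets (completion (restr_to_subalg (P \<mu>) raw_obs_field)) \<subseteq> sets (completion (P \<mu>))"
  proof
    fix A assume "A \<in> sets (completion (restr_to_subalg (P \<mu>) raw_obs_field))"
    then obtain S N N' where "A = S \<union> N" "N \<subseteq> N'"
      "N' \<in> null_sets (restr_to_subalg (P \<mu>) raw_obs_field)"
      "S \<in> sets (restr_to_subalg (P \<mu>) raw_obs_field)"
      by (rule sets_completionE)
    then show "A \<in> sets (completion (P \<mu>))"
      using sub by (intro sets_completionI[of A S N N'])
        (auto simp: null_sets_restr_to_subalg sets_restr_to_subalg subalgebra_def)
  qed
  then have "sets (obs_field P) \<subseteq> sets (completion (P \<mu>))"
    using obs_field_subset[of \<mu> P] assms by blast
  then show ?thesis
    by (simp add: subalgebra_def space_obs_field space_borel_probs assms)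
qed

lemma sets_obs_law:
  assumes "\<mu> \<in> borel_probs" "P \<mu> \<in> borel_probs"
  shows "sets (obs_law P \<mu>) = sets (obs_field P)"
  unfolding obs_law_def by (rule sets_restr_to_subalg[OF subalgebra_obs_field[of \<mu> P, OF assms]])

lemma space_obs_law: "P \<mu> \<in> borel_probs \<Longrightarrow> space (obs_law P \<mu>) = UNIV"
  by (simp add: obs_law_def space_restr_to_subalg space_borel_probs)

lemma prob_space_obs_law:
  assumes "\<mu> \<in> borel_probs" "P \<mu> \<in> borel_probs"
  shows "prob_space (obs_law P \<mu>)"
  unfolding obs_law_def using assms
  by (intro prob_space_restr_to_subalg subalgebra_obs_field prob_space.prob_space_completion)
    (auto simp: space_prob_algebra)

text \<open>A set of the completed field is a raw set up to a subset of a raw null set of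
  \<open>P \<mu>\<close>. Agreement on raw sets makes that null set null for \<open>P \<nu>\<close>
  too, so the same decomposition computes both values.\<close>

lemma obs_law_eqI:
  assumes \<mu>: "\<mu> \<in> borel_probs" "P \<mu> \<in> borel_probs" and \<nu>: "\<nu> \<in> borel_probs" "P \<nu> \<in> borel_probs"
    and eq: "\<And>A. A \<in> sets raw_obs_field \<Longrightarrow> emeasure (P \<mu>) A = emeasure (P \<nu>) A"
  shows "obs_law P \<mu> = obs_law P \<nu>"
proof (rule measure_eqI)
  show "sets (obs_law P \<mu>) = sets (obs_law P \<nu>)"
    using sets_obs_law[of _ P] \<mu> \<nu> by simp
  fix A assume "A \<in> sets (obs_law P \<mu>)"
  then have A: "A \<in> sets (obs_field P)" using sets_obs_law[of \<mu> P] \<mu> by simp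
  then have "A \<in> sets (completion (restr_to_subalg (P \<mu>) raw_obs_field))"
    using obs_field_subset[of \<mu> P] \<mu> by blast
  then obtain S N N' where SN: "A = S \<union> N" "N \<subseteq> N'"
    "N' \<in> null_sets (restr_to_subalg (P \<mu>) raw_obs_field)"
    "S \<in> sets (restr_to_subalg (P \<mu>) raw_obs_field)"
    by (rule sets_completionE)
  have S: "S \<in> sets raw_obs_field" and N': "N' \<in> sets raw_obs_field" "emeasure (P \<mu>) N' = 0"
    using SN subalgebra_raw_obs_field[OF \<mu>(2)]
    by (auto simp: sets_restr_to_subalg null_sets_restr_to_subalg)
  have value_A: "emeasure (obs_law P \<kappa>) A = emeasure (P \<kappa>) S"
    if \<kappa>: "\<kappa> \<in> borel_probs" "P \<kappa> \<in> borel_probs" and null: "emeasure (P \<kappa>) N' = 0" for \<kappa>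
  proof -
    have sets: "S \<in> sets (P \<kappa>)" "N' \<in> sets (P \<kappa>)"
      using S N' subalgebra_raw_obs_field[OF \<kappa>(2)] by (auto simp: subalgebra_def)
    then have N: "N \<in> null_sets (completion (P \<kappa>))"
      using null SN(2) by (intro null_sets_completion_subset[OF SN(2) null_sets_completionI]) auto
    have "emeasure (obs_law P \<kappa>) A = emeasure (completion (P \<kappa>)) A"
      unfolding obs_law_def by (rule emeasure_restr_to_subalg[OF subalgebra_obs_field[of \<kappa> P, OF \<kappa>] A])
    also have "\<dots> = emeasure (completion (P \<kappa>)) S"
      unfolding SN(1) using sets N by (intro emeasure_Un_null_set) auto
    also have "\<dots> = emeasure (P \<kappa>) S"
      using sets by simp
    finally show ?thesis .
  qed
  show "emeasure (obs_law P \<mu>) A = emeasure (obs_law P \<nu>) A"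
    using value_A[OF \<mu>] value_A[OF \<nu>] N' eq[OF S] eq[OF N'(1)] by simp
qed

text \<open>\<open>F\<close> is an admissible test function once it is viewed on the completed
  field; passing between \<open>P \<kappa>\<close> and \<open>obs_law P \<kappa>\<close> does not
  change its integral.\<close>

lemma integral_diff_le_tv_dist:
  assumes \<mu>: "\<mu> \<in> borel_probs" and \<nu>: "\<nu> \<in> borel_probs"
    and P: "\<And>\<mu>. \<mu> \<in> borel_probs \<Longrightarrow> P \<mu> \<in> borel_probs"
    and F: "F \<in> borel_measurable raw_obs_field" "\<And>\<omega>. \<bar>F \<omega>\<bar> \<le> 1"
  shows "\<bar>(\<integral>\<omega>. F \<omega> \<partial>P \<mu>) - (\<integral>\<omega>. F \<omega> \<partial>P \<nu>)\<bar> \<le> tv_dist (obs_law P \<mu>) (obs_law P \<nu>)"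
proof -
  have F_obs: "F \<in> borel_measurable (obs_field P)"
    using F(1) raw_obs_field_subset_obs_field[of P] P
    by (auto simp: measurable_def space_raw_obs_field space_obs_field)
  have int_F: "(\<integral>\<omega>. F \<omega> \<partial>obs_law P \<kappa>) = (\<integral>\<omega>. F \<omega> \<partial>P \<kappa>)" if \<kappa>: "\<kappa> \<in> borel_probs" for \<kappa>
  proof -
    have "F \<in> borel_measurable (P \<kappa>)"
      using F(1) subalgebra_raw_obs_field[OF P[OF \<kappa>]] by (rule measurable_from_subalg[rotated])
    then show ?thesis
      unfolding obs_law_def
      by (simp add: integral_subalgebra2[OF subalgebra_obs_field[of \<kappa> P, OF \<kappa> P[OF \<kappa>]] F_obs]
          integral_completion)
  qed
  \<comment> \<open>A real supremum dominates its members only if the family is bounded above; this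
    provides the bound 2.\<close>
  have le1: "\<bar>\<integral>\<omega>. f \<omega> \<partial>obs_law P \<kappa>\<bar> \<le> 1"
    if \<kappa>: "\<kappa> \<in> borel_probs" and f: "f \<in> borel_measurable (obs_field P)" "\<And>\<omega>. \<bar>f \<omega>\<bar> \<le> 1" for \<kappa> and f :: "_ \<Rightarrow> real"
  proof -
    interpret prob_space "obs_law P \<kappa>" using prob_space_obs_law[of \<kappa> P] \<kappa> P by blast
    have [measurable]: "f \<in> borel_measurable (obs_law P \<kappa>)"
      using f(1) measurable_cong_sets[OF sets_obs_law[of \<kappa> P] refl] \<kappa> P by blast
    have int: "integrable (obs_law P \<kappa>) f"
      using f(2) by (intro integrable_const_bound[where B = 1]) auto
    have "\<bar>\<integral>\<omega>. f \<omega> \<partial>obs_law P \<kappa>\<bar> \<le> (\<integral>\<omega>. \<bar>f \<omega>\<bar> \<partial>obs_law P \<kappa>)"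
      by (rule integral_abs_bound)
    also have "\<dots> \<le> 1"
      using f(2) int by (intro integral_le_const AE_I2) auto
    finally show ?thesis .
  qed
  let ?G = "{f. f \<in> borel_measurable (obs_law P \<mu>) \<and> (\<forall>\<omega>\<in>space (obs_law P \<mu>). \<bar>f \<omega>\<bar> \<le> 1)}"
  have G: "?G = {f. f \<in> borel_measurable (obs_field P) \<and> (\<forall>\<omega>. \<bar>f \<omega>\<bar> \<le> 1)}"
    using measurable_cong_sets[OF sets_obs_law[of \<mu> P] refl] \<mu> P space_obs_law[of P \<mu>] by auto
  have "\<bar>(\<integral>\<omega>. F \<omega> \<partial>obs_law P \<mu>) - (\<integral>\<omega>. F \<omega> \<partial>obs_law P \<nu>)\<bar> \<le> tv_dist (obs_law P \<mu>) (obs_law P \<nu>)"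
    unfolding tv_dist_def G
  proof (rule cSUP_upper)
    show "F \<in> {f. f \<in> borel_measurable (obs_field P) \<and> (\<forall>\<omega>. \<bar>f \<omega>\<bar> \<le> 1)}"
      using F_obs F(2) by simp
    show "bdd_above ((\<lambda>f :: _ \<Rightarrow> real. \<bar>(\<integral>\<omega>. f \<omega> \<partial>obs_law P \<mu>) - (\<integral>\<omega>. f \<omega> \<partial>obs_law P \<nu>)\<bar>) `
        {f. f \<in> borel_measurable (obs_field P) \<and> (\<forall>\<omega>. \<bar>f \<omega>\<bar> \<le> 1)})"
    proof (rule bdd_aboveI2)
      fix f :: "_ \<Rightarrow> real"
      assume "f \<in> {f. f \<in> borel_measurable (obs_field P) \<and> (\<forall>\<omega>. \<bar>f \<omega>\<bar> \<le> 1)}"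
      then show "\<bar>(\<integral>\<omega>. f \<omega> \<partial>obs_law P \<mu>) - (\<integral>\<omega>. f \<omega> \<partial>obs_law P \<nu>)\<bar> \<le> 2"
        using le1[OF \<mu>, of f] le1[OF \<nu>, of f] by auto
    qed
  qed
  then show ?thesis using int_F \<mu> \<nu> by simp
qed

subsection \<open>Finite-dimensional laws of the observations\<close>

lemma bounded_measurableI:
  "f \<in> borel_measurable borel \<Longrightarrow> (\<And>z. \<bar>f z\<bar> \<le> C) \<Longrightarrow> f \<in> bounded_measurable"
  unfolding bounded_measurable_def by blast

lemma bounded_measurable_times:
  assumes "f \<in> bounded_measurable" "g \<in> bounded_measurable"
  shows "(\<lambda>z. f z * g z) \<in> bounded_measurable"
proof -
  obtain C D where "\<And>z. \<bar>f z\<bar> \<le> C" "\<And>z. \<bar>g z\<bar> \<le> D"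
    using assms by (auto simp: bounded_measurable_def)
  then have "\<bar>f z * g z\<bar> \<le> C * D" for z
    unfolding abs_mult by (intro mult_mono) (auto intro: order_trans[OF abs_ge_zero])
  then show ?thesis
    using assms by (auto simp: bounded_measurable_def)
qed

lemma bounded_measurable_snd:
  fixes f :: "'b::second_countable_topology \<Rightarrow> real"
  assumes "f \<in> bounded_measurable"
  shows "(\<lambda>z :: 'a::second_countable_topology \<times> 'b. f (snd z)) \<in> bounded_measurable"
proof -
  have [measurable]: "f \<in> borel_measurable borel"
    using assms by (simp add: bounded_measurable_def)
  have "(\<lambda>z :: 'a \<times> 'b. f (snd z)) \<in> borel_measurable (borel \<Otimes>\<^sub>M borel)"
    by measurable
  then show ?thesis
    using assms by (auto simp: bounded_measurable_def borel_prod)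
qed

lemma vanishing_at_infinity_bounded:
  assumes "f \<in> vanishing_at_infinity"
  shows "\<exists>C. \<forall>z. \<bar>f z\<bar> \<le> C"
proof -
  let ?K = "{z. 1 \<le> \<bar>f z\<bar>}"
  have "compact ?K" "continuous_on ?K f"
    using assms by (auto simp: vanishing_at_infinity_def intro: continuous_on_subset)
  then have "bounded (f ` ?K)"
    by (intro compact_imp_bounded compact_continuous_image)
  then obtain C where C: "\<And>z. z \<in> ?K \<Longrightarrow> \<bar>f z\<bar> \<le> C"
    by (auto simp: bounded_iff)
  have "\<bar>f z\<bar> \<le> max C 1" for z
    using C[of z] by (cases "z \<in> ?K") auto
  then show ?thesis by blast
qed

lemma vanishing_at_infinity_bounded_measurable:
  "f \<in> vanishing_at_infinity \<Longrightarrow> f \<in> bounded_measurable"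
  using vanishing_at_infinity_bounded[of f] borel_measurable_continuous_onI[of f]
  by (auto simp: bounded_measurable_def vanishing_at_infinity_def)

lemma vanishing_at_infinity_times_bounded:
  fixes f g :: "'a::t2_space \<Rightarrow> real"
  assumes f: "f \<in> vanishing_at_infinity" and g: "continuous_on UNIV g" "\<And>z. \<bar>g z\<bar> \<le> C"
  shows "(\<lambda>z. f z * g z) \<in> vanishing_at_infinity"
proof -
  have f_cont: "continuous_on UNIV f"
    using f by (simp add: vanishing_at_infinity_def)
  have "compact {z. \<epsilon> \<le> \<bar>f z * g z\<bar>}" if "\<epsilon> > 0" for \<epsilon>
  proof -
    \<comment> \<open>Enlarging the bound to \<open>\<bar>C\<bar> + 1\<close> makes it positive, so
      that one can divide by it.\<close>
    have C: "\<bar>g z\<bar> \<le> \<bar>C\<bar> + 1" for z using g(2)[of z] by linarith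
    have "compact {z. \<epsilon> / (\<bar>C\<bar> + 1) \<le> \<bar>f z\<bar>}"
      using f \<open>\<epsilon> > 0\<close> by (auto simp: vanishing_at_infinity_def)
    moreover have "closed {z. \<epsilon> \<le> \<bar>f z * g z\<bar>}"
      using f_cont g(1) by (intro closed_Collect_le continuous_intros)
    ultimately have "compact ({z. \<epsilon> / (\<bar>C\<bar> + 1) \<le> \<bar>f z\<bar>} \<inter> {z. \<epsilon> \<le> \<bar>f z * g z\<bar>})"
      by (rule compact_Int_closed)
    moreover have "\<epsilon> / (\<bar>C\<bar> + 1) \<le> \<bar>f z\<bar>" if "\<epsilon> \<le> \<bar>f z * g z\<bar>" for z
    proof -
      have "\<epsilon> \<le> \<bar>f z\<bar> * (\<bar>C\<bar> + 1)"
        using that mult_left_mono[OF C[of z], of "\<bar>f z\<bar>"] by (simp add: abs_mult)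
      then show ?thesis by (simp add: pos_divide_le_eq)
    qed
    then have "{z. \<epsilon> / (\<bar>C\<bar> + 1) \<le> \<bar>f z\<bar>} \<inter> {z. \<epsilon> \<le> \<bar>f z * g z\<bar>} = {z. \<epsilon> \<le> \<bar>f z * g z\<bar>}"
      by blast
    ultimately show ?thesis by simp
  qed
  then show ?thesis
    using f_cont g(1) by (auto simp: vanishing_at_infinity_def intro: continuous_intros)
qed

text \<open>A function of the observation alone is constant along E, so it can vanish at infinity on
  the product because E is compact: its superlevel sets are E times a compact set.\<close>

lemma vanishing_at_infinity_snd:
  fixes f :: "'b::topological_space \<Rightarrow> real"
  assumes "compact (UNIV :: 'a::topological_space set)" "f \<in> vanishing_at_infinity"
  shows "(\<lambda>z :: 'a \<times> 'b. f (snd z)) \<in> vanishing_at_infinity"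
proof -
  have "compact {z :: 'a \<times> 'b. \<epsilon> \<le> \<bar>f (snd z)\<bar>}" if "\<epsilon> > 0" for \<epsilon>
  proof -
    have "{z :: 'a \<times> 'b. \<epsilon> \<le> \<bar>f (snd z)\<bar>} = UNIV \<times> {y. \<epsilon> \<le> \<bar>f y\<bar>}" by auto
    then show ?thesis
      using assms that by (auto simp: vanishing_at_infinity_def intro!: compact_Times)
  qed
  moreover have "continuous_on UNIV (\<lambda>z :: 'a \<times> 'b. f (snd z))"
    using assms(2) by (intro continuous_on_compose2[of UNIV f UNIV snd] continuous_intros)
      (auto simp: vanishing_at_infinity_def)
  ultimately show ?thesis by (simp add: vanishing_at_infinity_def)
qed

text \<open>The distance factor tends to the indicator of \<open>C\<close> but need not decay when
  \<open>C\<close> is unbounded; the cutoff in \<open>norm y\<close> restores decay and tends to 1.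
  The bound 1 serves both total variation and dominated convergence.\<close>

lemma indicator_closed_limit_vanishing:
  fixes C :: "'a::{real_normed_vector, heine_borel} set"
  assumes "closed C"
  obtains \<phi> :: "nat \<Rightarrow> 'a \<Rightarrow> real" where "\<And>k. \<phi> k \<in> vanishing_at_infinity"
    "\<And>k y. \<bar>\<phi> k y\<bar> \<le> 1" "\<And>y. (\<lambda>k. \<phi> k y) \<longlonglongrightarrow> indicator C y"
proof (cases "C = {}")
  case True
  show thesis
    by (rule that[of "\<lambda>_ _. 0"]) (auto simp: True vanishing_at_infinity_def)
next
  case False
  define \<phi> where "\<phi> k y = max 0 (1 - real k * infdist y C) * max 0 (1 - norm y / Suc k)"
    for k :: nat and y :: 'a
  show thesis
  proof
    fix k :: nat
    have cont: "continuous_on UNIV (\<phi> k)"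
      unfolding \<phi>_def by (intro continuous_intros) auto
    have "compact {y. \<epsilon> \<le> \<bar>\<phi> k y\<bar>}" if "\<epsilon> > 0" for \<epsilon>
    proof -
      have "closed {y. \<epsilon> \<le> \<bar>\<phi> k y\<bar>}"
        using cont by (intro closed_Collect_le continuous_intros)
      moreover have "{y. \<epsilon> \<le> \<bar>\<phi> k y\<bar>} \<subseteq> cball 0 (Suc k)"
      proof
        fix y assume "y \<in> {y. \<epsilon> \<le> \<bar>\<phi> k y\<bar>}"
        then have "\<phi> k y \<noteq> 0" using \<open>\<epsilon> > 0\<close> by auto
        then have "norm y / Suc k < 1" by (auto simp: \<phi>_def max_def split: if_splits)
        then show "y \<in> cball 0 (Suc k)" by (simp add: divide_less_eq)
      qed
      then have "bounded {y. \<epsilon> \<le> \<bar>\<phi> k y\<bar>}"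
        by (rule bounded_subset[OF bounded_cball])
      ultimately show ?thesis by (simp add: compact_eq_bounded_closed)
    qed
    with cont show "\<phi> k \<in> vanishing_at_infinity" by (simp add: vanishing_at_infinity_def)
    fix y :: 'a
    show "\<bar>\<phi> k y\<bar> \<le> 1"
      unfolding \<phi>_def abs_mult by (intro mult_le_one) (auto simp: infdist_nonneg)
  next
    fix y :: 'a
    have "(\<lambda>k. max 0 (1 - norm y / real (Suc k))) \<longlonglongrightarrow> max 0 (1 - 0)"
      by (intro tendsto_max tendsto_diff tendsto_const LIMSEQ_Suc[OF lim_const_over_n])
    then have lim: "(\<lambda>k. max 0 (1 - norm y / real (Suc k))) \<longlonglongrightarrow> 1" by simp
    show "(\<lambda>k. \<phi> k y) \<longlonglongrightarrow> indicator C y"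
    proof (cases "y \<in> C")
      case True
      then show ?thesis using lim by (simp add: \<phi>_def)
    next
      case out: False
      then have "infdist y C > 0"
        using assms False infdist_nonneg[of y C] in_closed_iff_infdist_zero[of C y] by linarith
      then obtain k\<^sub>0 :: nat where k0: "1 < real k\<^sub>0 * infdist y C"
        using reals_Archimedean3 by blast
      have "\<forall>\<^sub>F k in sequentially. \<phi> k y = 0"
        using eventually_ge_at_top[of k\<^sub>0]
      proof eventually_elim
        case (elim k)
        then have "real k\<^sub>0 * infdist y C \<le> real k * infdist y C"
          by (intro mult_right_mono) (auto simp: infdist_nonneg)
        then show ?case using k0 by (simp add: \<phi>_def)
      qed
      then show ?thesis using out by (simp add: tendsto_eventually)
    qed
  qed
qed

section \<open>Products of functions of the observations determine the observation law\<close>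

definition obs_product ::
    "(real \<times> (real ^ 'q \<Rightarrow> real)) list \<Rightarrow> ('e::polish_space, 'q::finite) path_space \<Rightarrow> real" where
  "obs_product L \<omega> = (\<Prod>(t, f)\<leftarrow>L. f (obs_at t \<omega>))"

lemma obs_product_simps [simp]:
  "obs_product [] \<omega> = 1"
  "obs_product ((t, f) # L) \<omega> = f (obs_at t \<omega>) * obs_product L \<omega>"
  by (simp_all add: obs_product_def)

lemma obs_product_measurable:
  assumes "\<And>t f. (t, f) \<in> set L \<Longrightarrow> 0 \<le> t \<and> f \<in> borel_measurable borel"
  shows "(obs_product L :: ('e::polish_space, 'q::finite) path_space \<Rightarrow> real) \<in> borel_measurable raw_obs_field"
  using assms
proof (induction L)
  case (Cons a L)
  obtain t f where a: "a = (t, f)" by (cases a)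
  have "(\<lambda>\<omega> :: ('e, 'q) path_space. f (obs_at t \<omega>)) \<in> borel_measurable raw_obs_field"
    using Cons.prems[of t f] a by (intro measurable_compose[OF measurable_obs_at_raw_obs_field]) auto
  moreover have "(obs_product L :: ('e, 'q) path_space \<Rightarrow> real) \<in> borel_measurable raw_obs_field"
    by (intro Cons.IH Cons.prems) simp
  ultimately show ?case unfolding a obs_product_simps by (rule borel_measurable_times)
qed (simp add: obs_product_def[abs_def])

lemma obs_product_le_1:
  assumes "\<And>t f y. (t, f) \<in> set L \<Longrightarrow> \<bar>f y\<bar> \<le> 1"
  shows "\<bar>obs_product L \<omega>\<bar> \<le> 1"
  using assms
proof (induction L)
  case (Cons a L)
  obtain t f where a: "a = (t, f)" by (cases a)
  have "\<bar>f (obs_at t \<omega>)\<bar> \<le> 1" "\<bar>obs_product L \<omega>\<bar> \<le> 1"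
    using Cons a by auto
  then show ?case by (simp add: a abs_mult mult_le_one)
qed simp

text \<open>Times may repeat and come in any order, so appending lists intersects cylinders and the
  family is a \<pi>-system; the empty list contributes the whole space.\<close>

definition closed_cylinders :: "('e::polish_space, 'q::finite) path_space set set" where
  "closed_cylinders =
     {\<Inter>(t, C)\<in>set L. obs_at t -` C | L. \<forall>(t, C)\<in>set L. 0 \<le> t \<and> closed C}"

lemma sets_raw_obs_field_closed_cylinders:
  "sets (raw_obs_field :: ('e::polish_space, 'q::finite) path_space measure) = sigma_sets UNIV closed_cylinders"
proof (rule antisym)
  let ?S = "sigma UNIV closed_cylinders :: ('e, 'q) path_space measure"
  have sets_S: "sets ?S = sigma_sets UNIV closed_cylinders" by simp
  have space_S: "space ?S = UNIV" by (simp add: space_measure_of_conv)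
  have obs: "obs_at t \<in> borel_measurable ?S" if "0 \<le> t" for t
  proof (rule borel_measurableI_closed)
    fix C :: "(real ^ 'q) set" assume "closed C"
    then have "obs_at t -` C \<in> (closed_cylinders :: ('e, 'q) path_space set set)"
      unfolding closed_cylinders_def using that by (intro CollectI exI[of _ "[(t, C)]"]) auto
    then show "obs_at t -` C \<inter> space ?S \<in> sets ?S" by (simp add: space_S)
  qed
  have "sets (raw_obs_filtration t :: ('e, 'q) path_space measure) \<subseteq> sets ?S" for t
    unfolding sets_raw_obs_filtration
  proof (intro sigma_algebra.sigma_sets_subset sigma_algebra_sets_UNIV space_S, safe)
    fix s :: real and A :: "(real ^ 'q) set" assume "0 \<le> s" "A \<in> sets borel"
    then show "obs_at s -` A \<in> sets ?S"
      using measurable_sets[OF obs] by (simp add: space_S)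
  qed
  then have "sets (raw_obs_field :: ('e, 'q) path_space measure) \<subseteq> sets ?S"
    unfolding sets_raw_obs_field
    by (intro sigma_algebra.sigma_sets_subset sigma_algebra_sets_UNIV space_S UN_least)
  then show "sets (raw_obs_field :: ('e, 'q) path_space measure) \<subseteq> sigma_sets UNIV closed_cylinders"
    unfolding sets_S .
  have "X \<in> sets raw_obs_field" if "X \<in> closed_cylinders" for X :: "('e, 'q) path_space set"
  proof -
    obtain L where X: "X = (\<Inter>(t, C)\<in>set L. obs_at t -` C)"
      and L: "\<forall>(t, C)\<in>set L. 0 \<le> t \<and> closed C"
      using \<open>X \<in> closed_cylinders\<close> unfolding closed_cylinders_def by blast
    show ?thesis unfolding X using L
    proof (induction L)
      case Nil
      show ?case using sets.top[of raw_obs_field] by (simp add: space_raw_obs_field)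
    next
      case (Cons a L)
      then show ?case
        using measurable_sets[OF measurable_obs_at_raw_obs_field[of "fst a"], of "snd a"]
        by (cases a) (auto simp: space_raw_obs_field)
    qed
  qed
  then show "sigma_sets UNIV closed_cylinders \<subseteq> sets (raw_obs_field :: ('e, 'q) path_space measure)"
    by (intro sigma_algebra.sigma_sets_subset sigma_algebra_sets_UNIV space_raw_obs_field) blast
qed

text \<open>Indicators of closed cylinders are bounded pointwise limits of products, so equality of
  expectations passes to cylinders by dominated convergence and from there to the generated
  field.\<close>

lemma emeasure_eq_on_raw_obs_field:
  fixes M N :: "('e::polish_space, 'q::finite) path_space measure"
  assumes M: "M \<in> borel_probs" and N: "N \<in> borel_probs"
    and eq: "\<And>L. sorted (map fst L) \<Longrightarrow>
      (\<And>t f. (t, f) \<in> set L \<Longrightarrow> 0 \<le> t \<and> f \<in> vanishing_at_infinity \<and> (\<forall>y. \<bar>f y\<bar> \<le> 1)) \<Longrightarrow>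
      (\<integral>\<omega>. obs_product L \<omega> \<partial>M) = (\<integral>\<omega>. obs_product L \<omega> \<partial>N)"
    and A: "A \<in> sets raw_obs_field"
  shows "emeasure M A = emeasure N A"
proof -
  have "\<forall>C :: (real ^ 'q) set. \<exists>\<phi>. closed C \<longrightarrow> (\<forall>k :: nat. \<phi> k \<in> vanishing_at_infinity) \<and>
      (\<forall>k y. \<bar>\<phi> k y\<bar> \<le> 1) \<and> (\<forall>y. (\<lambda>k. \<phi> k y) \<longlonglongrightarrow> indicator C y)"
    using indicator_closed_limit_vanishing by metis
  then obtain \<phi> where \<phi>: "\<And>C :: (real ^ 'q) set. closed C \<Longrightarrow> (\<forall>k :: nat. \<phi> C k \<in> vanishing_at_infinity) \<and>
      (\<forall>k y. \<bar>\<phi> C k y\<bar> \<le> 1) \<and> (\<forall>y. (\<lambda>k. \<phi> C k y) \<longlonglongrightarrow> indicator C y)"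
    by metis
  have cyl: "measure M X = measure N X" if X: "X \<in> closed_cylinders" for X
  proof -
    obtain L\<^sub>0 where "X = (\<Inter>(t, C)\<in>set L\<^sub>0. obs_at t -` C)" "\<forall>(t, C)\<in>set L\<^sub>0. 0 \<le> t \<and> closed C"
      using X unfolding closed_cylinders_def by blast
    \<comment> \<open>An intersection ignores the order of its members, so the times may be sorted,
      as the Markov property will require.\<close>
    then obtain L where L: "sorted (map fst L)" "X = (\<Inter>(t, C)\<in>set L. obs_at t -` C)"
        "\<And>t C. (t, C) \<in> set L \<Longrightarrow> 0 \<le> t \<and> closed C"
      using sorted_sort_key[of fst L\<^sub>0] set_sort[of fst L\<^sub>0] by (metis case_prodD)
    define Lk where "Lk k = map (\<lambda>(t, C). (t, \<phi> C k)) L" for k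
    have Lk: "0 \<le> t \<and> f \<in> vanishing_at_infinity \<and> (\<forall>y. \<bar>f y\<bar> \<le> 1)" if "(t, f) \<in> set (Lk k)" for t f k
      using that L(3) \<phi> by (auto simp: Lk_def)
    have sorted_Lk: "sorted (map fst (Lk k))" for k
      using L(1) by (simp add: Lk_def case_prod_unfold comp_def)
    have lim: "(\<lambda>k. obs_product (Lk k) \<omega>) \<longlonglongrightarrow> indicator X \<omega>" for \<omega>
    proof -
      have "(\<lambda>k. obs_product (map (\<lambda>(t, C). (t, \<phi> C k)) K) \<omega>) \<longlonglongrightarrow>
          indicator (\<Inter>(t, C)\<in>set K. obs_at t -` C) \<omega>" if "set K \<subseteq> set L" for K
        using that
      proof (induction K)
        case (Cons a K)
        obtain t C where a: "a = (t, C)" by (cases a)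
        have "(\<lambda>k. \<phi> C k (obs_at t \<omega>)) \<longlonglongrightarrow> indicator C (obs_at t \<omega>)"
          using Cons.prems L(3) \<phi> a by auto
        then have "(\<lambda>k. \<phi> C k (obs_at t \<omega>) * obs_product (map (\<lambda>(t, C). (t, \<phi> C k)) K) \<omega>) \<longlonglongrightarrow>
            indicator C (obs_at t \<omega>) * indicator (\<Inter>(t, C)\<in>set K. obs_at t -` C) \<omega>"
          using Cons by (intro tendsto_mult) auto
        then show ?case by (simp add: a indicator_def of_bool_conj)
      qed simp
      from this[of L] show ?thesis by (simp add: Lk_def L(2))
    qed
    have X_sets: "X \<in> sets raw_obs_field"
      using X by (simp add: sets_raw_obs_field_closed_cylinders)
    have conv: "(\<lambda>k. \<integral>\<omega>. obs_product (Lk k) \<omega> \<partial>Q) \<longlonglongrightarrow> measure Q X" if Q: "Q \<in> borel_probs" for Q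
    proof -
      note sub = subalgebra_raw_obs_field[OF Q]
      have "X \<in> sets Q" using X_sets sub by (auto simp: subalgebra_def)
      have meas: "obs_product (Lk k) \<in> borel_measurable Q" for k
      proof (intro measurable_from_subalg[OF sub] obs_product_measurable)
        fix t f assume "(t, f) \<in> set (Lk k)"
        then show "0 \<le> t \<and> f \<in> borel_measurable borel"
          using Lk[of t f k] vanishing_at_infinity_bounded_measurable[of f]
          by (simp add: bounded_measurable_def)
      qed
      have "(\<lambda>k. \<integral>\<omega>. obs_product (Lk k) \<omega> \<partial>Q) \<longlonglongrightarrow> (\<integral>\<omega>. indicator X \<omega> \<partial>Q)"
      proof (rule integral_dominated_convergence[where w = "\<lambda>_. 1"])
        show "integrable Q (\<lambda>_. 1 :: real)"
          using Q prob_space.finite_measure[of Q]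
          by (auto simp: space_prob_algebra intro: finite_measure.integrable_const)
        show "AE \<omega> in Q. norm (obs_product (Lk k) \<omega>) \<le> 1" for k
          using Lk by (auto intro!: AE_I2 obs_product_le_1)
      qed (use meas lim \<open>X \<in> sets Q\<close> in auto)
      then show ?thesis using \<open>X \<in> sets Q\<close> sets.sets_into_space[of X Q] by (simp add: Int_absorb2)
    qed
    have "(\<integral>\<omega>. obs_product (Lk k) \<omega> \<partial>M) = (\<integral>\<omega>. obs_product (Lk k) \<omega> \<partial>N)" for k
      using sorted_Lk Lk by (rule eq)
    then show ?thesis
      using conv[OF M] conv[OF N] LIMSEQ_unique by simp
  qed
  \<comment> \<open>The cylinders generate only the raw observation field, so the uniqueness theorem
    is applied to the restrictions.\<close>
  have "restr_to_subalg M raw_obs_field = restr_to_subalg N raw_obs_field"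
  proof (rule measure_eqI_generator_eq[where E = closed_cylinders and \<Omega> = UNIV and A = "\<lambda>_. UNIV"])
    show "Int_stable (closed_cylinders :: ('e, 'q) path_space set set)"
    proof (rule Int_stableI)
      fix a b :: "('e, 'q) path_space set" assume "a \<in> closed_cylinders" "b \<in> closed_cylinders"
      then obtain K L where "a = (\<Inter>(t, C)\<in>set K. obs_at t -` C)" "\<forall>(t, C)\<in>set K. 0 \<le> t \<and> closed C"
        "b = (\<Inter>(t, C)\<in>set L. obs_at t -` C)" "\<forall>(t, C)\<in>set L. 0 \<le> t \<and> closed C"
        unfolding closed_cylinders_def by blast
      then show "a \<inter> b \<in> closed_cylinders"
        unfolding closed_cylinders_def by (intro CollectI exI[of _ "K @ L"]) (auto simp: INT_Un)
    qed
    show "emeasure (restr_to_subalg M raw_obs_field) X = emeasure (restr_to_subalg N raw_obs_field) X"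
      if "X \<in> closed_cylinders" for X
    proof -
      have "X \<in> sets raw_obs_field"
        using that by (simp add: sets_raw_obs_field_closed_cylinders)
      moreover have "finite_measure M" "finite_measure N"
        using M N by (auto simp: space_prob_algebra prob_space.finite_measure)
      ultimately show ?thesis
        using cyl[OF that] M N
        by (simp add: emeasure_restr_to_subalg subalgebra_raw_obs_field finite_measure.emeasure_eq_measure)
    qed
    show "range (\<lambda>_. UNIV) \<subseteq> (closed_cylinders :: ('e, 'q) path_space set set)"
      unfolding closed_cylinders_def by (auto intro!: exI[of _ "[]"])
    show "emeasure (restr_to_subalg M raw_obs_field) UNIV \<noteq> \<infinity>"
    proof -
      have "finite_measure (restr_to_subalg M raw_obs_field)"
        using M by (intro finite_measure_restr_to_subalg subalgebra_raw_obs_field)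
          (auto simp: space_prob_algebra prob_space.finite_measure)
      then show ?thesis by (simp add: finite_measure.emeasure_finite)
    qed
  qed (auto simp: sets_restr_to_subalg subalgebra_raw_obs_field M N sets_raw_obs_field_closed_cylinders)
  then show ?thesis
    using A M N by (metis emeasure_restr_to_subalg subalgebra_raw_obs_field)
qed

text \<open>\<open>obs_product_kernel T s L z\<close> is the conditional expectation of \<open>obs_product L\<close> given
  \<open>(X\<^sub>s, Y\<^sub>s) = z\<close>, for times of \<open>L\<close> that increase from \<open>s\<close> on.\<close>

fun obs_product_kernel ::
    "(real \<Rightarrow> ('e \<times> 'y \<Rightarrow> real) \<Rightarrow> 'e \<times> 'y \<Rightarrow> real) \<Rightarrow> real \<Rightarrow> (real \<times> ('y \<Rightarrow> real)) list \<Rightarrow> 'e \<times> 'y \<Rightarrow> real" where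
  "obs_product_kernel T s [] = (\<lambda>_. 1)"
| "obs_product_kernel T s ((t, f) # L) = T (t - s) (\<lambda>z. f (snd z) * obs_product_kernel T t L z)"

section \<open>Conditioning backwards along the observation times\<close>

context hidden_markov_model
begin

lemma obs_product_kernel_bounded_measurable:
  assumes "sorted (s # map fst L)" "\<And>t f. (t, f) \<in> set L \<Longrightarrow> f \<in> bounded_measurable"
  shows "obs_product_kernel T s L \<in> bounded_measurable"
  using assms
proof (induction L arbitrary: s)
  case Nil
  show ?case by (auto intro: bounded_measurableI[of _ 1])
next
  case (Cons a L)
  obtain t f where a: "a = (t, f)" by (cases a)
  have "obs_product_kernel T t L \<in> bounded_measurable"
    using Cons a by auto
  then show ?case
    using Cons.prems a
    by (auto intro!: maps_bounded_measurable bounded_measurable_times bounded_measurable_snd)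
qed

text \<open>The innermost kernel is the constant 1, which does not vanish at infinity because the
  observation space may be unbounded. The induction therefore carries only continuity; each factor
  \<open>f (snd z)\<close> brings decay back before the semigroup acts, so the Feller property
  applies at every stage.\<close>

lemma obs_product_kernel_continuous:
  assumes E: "compact (UNIV :: 'e set)" and "feller T"
    and "sorted (s # map fst L)" "\<And>t f. (t, f) \<in> set L \<Longrightarrow> f \<in> vanishing_at_infinity"
  shows "continuous_on UNIV (obs_product_kernel T s L)"
  using assms(3,4)
proof (induction L arbitrary: s)
  case (Cons a L)
  obtain t f where a: "a = (t, f)" by (cases a)
  have cont: "continuous_on UNIV (obs_product_kernel T t L)"
    using Cons a by auto
  have "obs_product_kernel T t L \<in> bounded_measurable"
    using Cons.prems a vanishing_at_infinity_bounded_measurable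
    by (intro obs_product_kernel_bounded_measurable) auto
  then obtain C where "\<And>z. \<bar>obs_product_kernel T t L z\<bar> \<le> C"
    by (auto simp: bounded_measurable_def)
  then have "(\<lambda>z. f (snd z) * obs_product_kernel T t L z) \<in> vanishing_at_infinity"
    using cont Cons.prems(2) a
    by (intro vanishing_at_infinity_times_bounded vanishing_at_infinity_snd E) auto
  then have "T (t - s) (\<lambda>z. f (snd z) * obs_product_kernel T t L z) \<in> vanishing_at_infinity"
    using \<open>feller T\<close> Cons.prems(1) a by (auto simp: feller_def)
  then show ?case by (simp add: a vanishing_at_infinity_def)
qed simp

lemma measurable_signal_obs_at:
  assumes "\<mu> \<in> borel_probs" "0 \<le> t" "f \<in> bounded_measurable"
  shows "(\<lambda>\<omega>. f (signal_at t \<omega>, obs_at t \<omega>)) \<in> borel_measurable (P \<mu>)"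
proof -
  have [measurable_cong]: "sets (P \<mu>) = sets borel"
    using law[OF assms(1)] by (simp add: space_prob_algebra)
  have f: "f \<in> borel_measurable (borel \<Otimes>\<^sub>M borel)"
    using assms(3) by (simp add: bounded_measurable_def borel_prod)
  note [measurable] = measurable_signal_at[OF assms(2)] measurable_obs_at[OF assms(2)]
  have "(\<lambda>\<omega>. (signal_at t \<omega>, obs_at t \<omega>)) \<in> P \<mu> \<rightarrow>\<^sub>M borel \<Otimes>\<^sub>M borel"
    by measurable
  from measurable_compose[OF this f] show ?thesis .
qed

text \<open>An integrated form of the Markov property, free of completions. It applies to past
  factors \<open>G\<close> of the raw filtration since this lies inside the augmented one.\<close>

lemma markov_integral:
  assumes \<mu>: "\<mu> \<in> borel_probs" and f: "f \<in> bounded_measurable" and t: "0 \<le> s" "s \<le> t"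
    and G: "G \<in> borel_measurable (raw_filtration s)" "\<And>\<omega>. \<bar>G \<omega>\<bar> \<le> C"
  shows "(\<integral>\<omega>. G \<omega> * f (signal_at t \<omega>, obs_at t \<omega>) \<partial>P \<mu>) =
    (\<integral>\<omega>. G \<omega> * T (t - s) f (signal_at s \<omega>, obs_at s \<omega>) \<partial>P \<mu>)"
proof -
  interpret prob_space "P \<mu>"
    using law[OF \<mu>] by (simp add: space_prob_algebra)
  interpret comp: prob_space "completion (P \<mu>)"
    by (rule prob_space_completion)
  have sub: "subalgebra (completion (P \<mu>)) (augmented_filtration P s)"
    using \<mu> law[OF \<mu>] by (rule subalgebra_augmented_filtration)
  interpret sub: finite_measure_subalgebra "completion (P \<mu>)" "augmented_filtration P s"
    by standard (rule sub)
  have sets_P: "sets (P \<mu>) = sets borel"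
    using law[OF \<mu>] by (simp add: space_prob_algebra)
  have Tf: "T (t - s) f \<in> bounded_measurable"
    using t f by (intro maps_bounded_measurable) auto
  have G_P [measurable]: "G \<in> borel_measurable (P \<mu>)"
    using G(1) raw_filtration_subset_borel[of s]
    by (auto simp: measurable_def sets_P space_raw_filtration space_borel_probs[OF law[OF \<mu>]])
  have G_aug: "G \<in> borel_measurable (augmented_filtration P s)"
    using G(1) raw_filtration_subset_augmented[of s P]
    by (auto simp: measurable_def space_raw_filtration space_augmented_filtration)
  have f_P [measurable]: "(\<lambda>\<omega>. f (signal_at t \<omega>, obs_at t \<omega>)) \<in> borel_measurable (P \<mu>)"
    using \<mu> t f by (intro measurable_signal_obs_at) auto
  have Tf_P [measurable]: "(\<lambda>\<omega>. T (t - s) f (signal_at s \<omega>, obs_at s \<omega>)) \<in> borel_measurable (P \<mu>)"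
    using \<mu> t Tf by (intro measurable_signal_obs_at) auto
  obtain D where D: "\<And>z. \<bar>f z\<bar> \<le> D"
    using f by (auto simp: bounded_measurable_def)
  have "\<bar>G \<omega> * f (signal_at t \<omega>, obs_at t \<omega>)\<bar> \<le> C * D" for \<omega>
    unfolding abs_mult using G(2) D by (intro mult_mono) (auto intro: order_trans[OF abs_ge_zero])
  then have "integrable (P \<mu>) (\<lambda>\<omega>. G \<omega> * f (signal_at t \<omega>, obs_at t \<omega>))"
    by (intro integrable_const_bound[where B = "C * D"]) auto
  then have int: "integrable (completion (P \<mu>)) (\<lambda>\<omega>. G \<omega> * f (signal_at t \<omega>, obs_at t \<omega>))"
    by (subst integrable_completion) auto
  let ?ce = "real_cond_exp (completion (P \<mu>)) (augmented_filtration P s) (\<lambda>\<omega>. f (signal_at t \<omega>, obs_at t \<omega>))"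
  have "(\<integral>\<omega>. G \<omega> * f (signal_at t \<omega>, obs_at t \<omega>) \<partial>P \<mu>) =
      (\<integral>\<omega>. G \<omega> * f (signal_at t \<omega>, obs_at t \<omega>) \<partial>completion (P \<mu>))"
    by (subst integral_completion) auto
  also have "\<dots> = (\<integral>\<omega>. G \<omega> * ?ce \<omega> \<partial>completion (P \<mu>))"
    by (rule sub.real_cond_exp_intg(2)[OF int G_aug, symmetric]) (rule measurable_completion[OF f_P])
  also have "\<dots> = (\<integral>\<omega>. G \<omega> * T (t - s) f (signal_at s \<omega>, obs_at s \<omega>) \<partial>completion (P \<mu>))"
  proof (rule integral_cong_AE)
    have "G \<in> borel_measurable (completion (P \<mu>))"
      by (rule measurable_completion[OF G_P])
    then show "(\<lambda>\<omega>. G \<omega> * ?ce \<omega>) \<in> borel_measurable (completion (P \<mu>))"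
      by (intro borel_measurable_times borel_measurable_cond_exp2)
    show "(\<lambda>\<omega>. G \<omega> * T (t - s) f (signal_at s \<omega>, obs_at s \<omega>)) \<in> borel_measurable (completion (P \<mu>))"
      by (intro measurable_completion) measurable
    show "AE \<omega> in completion (P \<mu>). G \<omega> * ?ce \<omega> = G \<omega> * T (t - s) f (signal_at s \<omega>, obs_at s \<omega>)"
      using markov[OF \<mu> f t] by eventually_elim simp
  qed
  also have "\<dots> = (\<integral>\<omega>. G \<omega> * T (t - s) f (signal_at s \<omega>, obs_at s \<omega>) \<partial>P \<mu>)"
    by (subst integral_completion) auto
  finally show ?thesis .
qed

text \<open>The arbitrary past factor \<open>G\<close> is what makes the induction work: the first
  observation \<open>f (obs_at t \<omega>)\<close> is absorbed into it, the remaining product is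
  conditioned at time \<open>t\<close>, and then one Markov step leads back to
  \<open>s\<close>.\<close>

lemma integral_obs_product_conditioned:
  assumes \<mu>: "\<mu> \<in> borel_probs" and s: "0 \<le> s" "sorted (s # map fst L)"
    and L: "\<And>t f. (t, f) \<in> set L \<Longrightarrow> f \<in> bounded_measurable"
    and G: "G \<in> borel_measurable (raw_filtration s)" "\<And>\<omega>. \<bar>G \<omega>\<bar> \<le> C"
  shows "(\<integral>\<omega>. G \<omega> * obs_product L \<omega> \<partial>P \<mu>) =
    (\<integral>\<omega>. G \<omega> * obs_product_kernel T s L (signal_at s \<omega>, obs_at s \<omega>) \<partial>P \<mu>)"
  using s L G
proof (induction L arbitrary: s G C)
  case (Cons a L)
  obtain t f where a: "a = (t, f)" by (cases a)
  have t: "0 \<le> t" "s \<le> t" using Cons.prems a by auto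
  have f: "f \<in> bounded_measurable" using Cons.prems(3) a by auto
  then obtain D where D: "\<And>z. \<bar>f z\<bar> \<le> D" by (auto simp: bounded_measurable_def)
  have kernel: "obs_product_kernel T t L \<in> bounded_measurable"
    using Cons.prems a by (intro obs_product_kernel_bounded_measurable) auto
  have "G \<in> borel_measurable (raw_filtration t)"
    using Cons.prems(4) raw_filtration_mono[OF t(2)]
    by (auto simp: measurable_def space_raw_filtration)
  moreover have "(\<lambda>\<omega>. f (obs_at t \<omega>)) \<in> borel_measurable (raw_filtration t)"
    using f t by (intro measurable_compose[OF measurable_obs_at_raw_filtration])
      (auto simp: bounded_measurable_def)
  ultimately have G': "(\<lambda>\<omega>. G \<omega> * f (obs_at t \<omega>)) \<in> borel_measurable (raw_filtration t)"
    by (rule borel_measurable_times)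
  have "\<bar>G \<omega> * f (obs_at t \<omega>)\<bar> \<le> C * D" for \<omega>
    unfolding abs_mult using Cons.prems(5) D
    by (intro mult_mono) (auto intro: order_trans[OF abs_ge_zero])
  then have "(\<integral>\<omega>. (G \<omega> * f (obs_at t \<omega>)) * obs_product L \<omega> \<partial>P \<mu>) =
      (\<integral>\<omega>. (G \<omega> * f (obs_at t \<omega>)) * obs_product_kernel T t L (signal_at t \<omega>, obs_at t \<omega>) \<partial>P \<mu>)"
    using Cons.prems a t G' by (intro Cons.IH) auto
  then have "(\<integral>\<omega>. G \<omega> * obs_product (a # L) \<omega> \<partial>P \<mu>) =
      (\<integral>\<omega>. G \<omega> * (\<lambda>z. f (snd z) * obs_product_kernel T t L z) (signal_at t \<omega>, obs_at t \<omega>) \<partial>P \<mu>)"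
    by (simp add: a mult.assoc)
  also have "\<dots> = (\<integral>\<omega>. G \<omega> * T (t - s) (\<lambda>z. f (snd z) * obs_product_kernel T t L z)
      (signal_at s \<omega>, obs_at s \<omega>) \<partial>P \<mu>)"
    using Cons.prems t \<mu> f kernel
    by (intro markov_integral bounded_measurable_times bounded_measurable_snd)
  finally show ?case by (simp add: a)
qed simp

text \<open>The case \<open>G = 1\<close> and \<open>s = 0\<close>. The initial law enters through
  \<open>marginal\<close> at time 0, where \<open>T 0\<close> is the identity and the observation
  starts in 0.\<close>

lemma integral_obs_product:
  assumes \<mu>: "\<mu> \<in> borel_probs" and L: "sorted (map fst L)"
    "\<And>t f. (t, f) \<in> set L \<Longrightarrow> 0 \<le> t \<and> f \<in> bounded_measurable"
  shows "(\<integral>\<omega>. obs_product L \<omega> \<partial>P \<mu>) = (\<integral>x. obs_product_kernel T 0 L (x, 0) \<partial>\<mu>)"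
proof -
  have sorted: "sorted (0 # map fst L)"
    using L by auto
  then have kernel: "obs_product_kernel T 0 L \<in> bounded_measurable"
    using L(2) by (intro obs_product_kernel_bounded_measurable) auto
  have "(\<integral>\<omega>. obs_product L \<omega> \<partial>P \<mu>) =
      (\<integral>\<omega>. obs_product_kernel T 0 L (signal_at 0 \<omega>, obs_at 0 \<omega>) \<partial>P \<mu>)"
    using integral_obs_product_conditioned[OF \<mu> _ sorted, of "\<lambda>_. 1" 1] L(2) by simp
  also have "\<dots> = (\<integral>x. T 0 (obs_product_kernel T 0 L) (x, 0) \<partial>\<mu>)"
    by (rule marginal[OF \<mu> kernel]) simp
  finally show ?thesis by (simp add: at_zero[OF kernel])
qed

lemma obs_law_limits_eq:
  assumes E: "compact (UNIV :: 'e set)" and "feller T"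
    and \<mu>: "\<And>n. \<mu> n \<in> borel_probs" and \<nu>: "\<And>n. \<nu> n \<in> borel_probs"
    and M: "M \<in> borel_probs" and N: "N \<in> borel_probs"
    and \<mu>_M: "\<And>f :: 'e \<Rightarrow> real. continuous_on UNIV f \<Longrightarrow> (\<lambda>n. \<integral>x. f x \<partial>\<mu> n) \<longlonglongrightarrow> (\<integral>x. f x \<partial>M)"
    and \<nu>_N: "\<And>f :: 'e \<Rightarrow> real. continuous_on UNIV f \<Longrightarrow> (\<lambda>n. \<integral>x. f x \<partial>\<nu> n) \<longlonglongrightarrow> (\<integral>x. f x \<partial>N)"
    and tv: "(\<lambda>n. tv_dist (obs_law P (\<mu> n)) (obs_law P (\<nu> n))) \<longlonglongrightarrow> 0"
  shows "obs_law P M = obs_law P N"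
proof (rule obs_law_eqI[OF M law[OF M] N law[OF N]],
    rule emeasure_eq_on_raw_obs_field[OF law[OF M] law[OF N]])
  fix L :: "(real \<times> (real ^ 'q \<Rightarrow> real)) list"
  assume sorted: "sorted (map fst L)"
    and L: "\<And>t f. (t, f) \<in> set L \<Longrightarrow> 0 \<le> t \<and> f \<in> vanishing_at_infinity \<and> (\<forall>y. \<bar>f y\<bar> \<le> 1)"
  have L': "0 \<le> t \<and> f \<in> bounded_measurable" if "(t, f) \<in> set L" for t f
    using L[OF that] vanishing_at_infinity_bounded_measurable by blast
  have "continuous_on UNIV (obs_product_kernel T 0 L)"
    using sorted L by (intro obs_product_kernel_continuous E \<open>feller T\<close>) auto
  \<comment> \<open>Fixing the initial observation at 0 leaves a function on E alone, as weak
    convergence of the initial laws requires.\<close>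
  then have cont: "continuous_on UNIV (\<lambda>x. obs_product_kernel T 0 L (x, 0))"
    by (rule continuous_on_compose2) (auto intro: continuous_intros)
  have "(\<lambda>n. (\<integral>\<omega>. obs_product L \<omega> \<partial>P (\<mu> n)) - (\<integral>\<omega>. obs_product L \<omega> \<partial>P (\<nu> n))) \<longlonglongrightarrow>
      (\<integral>\<omega>. obs_product L \<omega> \<partial>P M) - (\<integral>\<omega>. obs_product L \<omega> \<partial>P N)"
    using \<mu>_M[OF cont] \<nu>_N[OF cont]
    by (simp add: integral_obs_product[OF _ sorted L'] \<mu> \<nu> M N tendsto_diff)
  moreover have "(\<lambda>n. (\<integral>\<omega>. obs_product L \<omega> \<partial>P (\<mu> n)) - (\<integral>\<omega>. obs_product L \<omega> \<partial>P (\<nu> n))) \<longlonglongrightarrow> 0"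
  \<comment> \<open>The factors are bounded by 1, so the product is itself a test function for the
    total variation distance.\<close>
  proof (rule Lim_null_comparison[OF always_eventually tv], rule allI)
    fix n
    have "\<bar>(\<integral>\<omega>. obs_product L \<omega> \<partial>P (\<mu> n)) - (\<integral>\<omega>. obs_product L \<omega> \<partial>P (\<nu> n))\<bar>
        \<le> tv_dist (obs_law P (\<mu> n)) (obs_law P (\<nu> n))"
    proof (rule integral_diff_le_tv_dist)
      show "(obs_product L :: ('e, 'q) path_space \<Rightarrow> real) \<in> borel_measurable raw_obs_field"
        using L' by (intro obs_product_measurable) (auto simp: bounded_measurable_def)
      show "\<bar>obs_product L \<omega>\<bar> \<le> 1" for \<omega> :: "('e, 'q) path_space"
        using L by (intro obs_product_le_1) blast
    qed (rule \<mu> \<nu> law, assumption?)+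
    then show "norm ((\<integral>\<omega>. obs_product L \<omega> \<partial>P (\<mu> n)) - (\<integral>\<omega>. obs_product L \<omega> \<partial>P (\<nu> n)))
        \<le> tv_dist (obs_law P (\<mu> n)) (obs_law P (\<nu> n))"
      by simp
  qed
  ultimately show "(\<integral>\<omega>. obs_product L \<omega> \<partial>P M) = (\<integral>\<omega>. obs_product L \<omega> \<partial>P N)"
    using LIMSEQ_unique by fastforce
qed

end

theorem proposition3p5:
  fixes P :: "'e::polish_space measure \<Rightarrow> ('e, 'q::finite) path_space measure"
    and T :: "real \<Rightarrow> ('e \<times> (real ^ 'q) \<Rightarrow> real) \<Rightarrow> 'e \<times> (real ^ 'q) \<Rightarrow> real"
  assumes "hidden_markov_model P T"
    and "compact (UNIV :: 'e set)"
    and "feller T"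
    and "observable P"
  shows "uniformly_observable P"
  unfolding uniformly_observable_def
proof (intro allI impI)
  interpret hidden_markov_model P T by fact
  fix \<mu> \<nu> :: "nat \<Rightarrow> 'e measure"
  assume \<mu>: "\<forall>n. \<mu> n \<in> borel_probs" and \<nu>: "\<forall>n. \<nu> n \<in> borel_probs"
    and tv: "(\<lambda>n. tv_dist (obs_law P (\<mu> n)) (obs_law P (\<nu> n))) \<longlonglongrightarrow> 0"
  show "(\<lambda>n. bl_dist (\<mu> n) (\<nu> n)) \<longlonglongrightarrow> 0"
  \<comment> \<open>With a single \<open>p\<close> fixed, failure of convergence yields a gap
    \<epsilon> along a whole subsequence, which every further extraction inherits.\<close>
  proof (rule bl_dist_tendsto_zero[OF assms(2)])
    fix p :: "'e \<Rightarrow> real" assume p: "continuous_on UNIV p"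
    define d where "d n = (\<integral>x. p x \<partial>\<mu> n) - (\<integral>x. p x \<partial>\<nu> n)" for n
    have "d \<longlonglongrightarrow> 0"
    proof (rule ccontr)
      assume "\<not> d \<longlonglongrightarrow> 0"
      then obtain \<epsilon> where "\<epsilon> > 0" and far: "\<forall>n\<^sub>0. \<exists>n\<ge>n\<^sub>0. \<epsilon> \<le> \<bar>d n\<bar>"
        by (auto simp: lim_sequentially not_less)
      then have "infinite {n. \<epsilon> \<le> \<bar>d n\<bar>}"
        by (simp add: infinite_nat_iff_unbounded_le)
      then obtain r :: "nat \<Rightarrow> nat" where r: "strict_mono r" "\<And>n. \<epsilon> \<le> \<bar>d (r n)\<bar>"
        using infinite_enumerate by blast
      obtain r1 M where r1: "strict_mono (r1 :: nat \<Rightarrow> nat)" and M: "M \<in> borel_probs"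
        "\<And>f :: 'e \<Rightarrow> real. continuous_on UNIV f \<Longrightarrow> (\<lambda>n. \<integral>x. f x \<partial>\<mu> (r (r1 n))) \<longlonglongrightarrow> (\<integral>x. f x \<partial>M)"
        using borel_probs_sequentially_compact[OF assms(2), of "\<lambda>n. \<mu> (r n)"] \<mu> by metis
      \<comment> \<open>The second extraction is made inside the first, so the convergence to
        \<open>M\<close> persists along it.\<close>
      obtain r2 N where r2: "strict_mono (r2 :: nat \<Rightarrow> nat)" and N: "N \<in> borel_probs"
        "\<And>f :: 'e \<Rightarrow> real. continuous_on UNIV f \<Longrightarrow> (\<lambda>n. \<integral>x. f x \<partial>\<nu> (r (r1 (r2 n)))) \<longlonglongrightarrow> (\<integral>x. f x \<partial>N)"
        using borel_probs_sequentially_compact[OF assms(2), of "\<lambda>n. \<nu> (r (r1 n))"] \<nu> by metis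
      define \<rho> where "\<rho> n = r (r1 (r2 n))" for n
      have "strict_mono \<rho>"
        using r(1) r1 r2 by (simp add: \<rho>_def strict_mono_def)
      from LIMSEQ_subseq_LIMSEQ[OF tv this]
      have tv': "(\<lambda>n. tv_dist (obs_law P (\<mu> (\<rho> n))) (obs_law P (\<nu> (\<rho> n)))) \<longlonglongrightarrow> 0"
        by (simp add: comp_def)
      have \<mu>_M: "(\<lambda>n. \<integral>x. f x \<partial>\<mu> (\<rho> n)) \<longlonglongrightarrow> (\<integral>x. f x \<partial>M)" if "continuous_on UNIV f" for f :: "'e \<Rightarrow> real"
        using LIMSEQ_subseq_LIMSEQ[OF M(2)[OF that] r2] by (simp add: comp_def \<rho>_def)
      have \<nu>_N: "(\<lambda>n. \<integral>x. f x \<partial>\<nu> (\<rho> n)) \<longlonglongrightarrow> (\<integral>x. f x \<partial>N)" if "continuous_on UNIV f" for f :: "'e \<Rightarrow> real"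
        using N(2)[OF that] by (simp add: \<rho>_def)
      have "obs_law P M = obs_law P N"
        using \<mu> \<nu> M(1) N(1) \<mu>_M \<nu>_N tv' by (intro obs_law_limits_eq[OF assms(2,3)]) auto
      then have "M = N"
        using assms(4) M(1) N(1) by (auto simp: observable_def)
      then have "(\<lambda>n. d (\<rho> n)) \<longlonglongrightarrow> 0"
        unfolding d_def using tendsto_diff[OF \<mu>_M[OF p] \<nu>_N[OF p]] by simp
      then have "\<forall>\<^sub>F n in sequentially. \<bar>d (\<rho> n)\<bar> < \<epsilon>"
        using tendstoD[OF _ \<open>\<epsilon> > 0\<close>] by fastforce
      then obtain n where "\<bar>d (\<rho> n)\<bar> < \<epsilon>"
        using eventually_happens by force
      then show False using r(2)[of "r1 (r2 n)"] by (simp add: \<rho>_def)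
    qed
    then show "(\<lambda>n. (\<integral>x. p x \<partial>\<mu> n) - (\<integral>x. p x \<partial>\<nu> n)) \<longlonglongrightarrow> 0"
      unfolding d_def[abs_def] .
  qed (use \<mu> \<nu> in auto)
qed

end
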